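(* Let $g$ be a Riemannian metric on $Q$, $L(v)=\frac12 g(v,v)$, $\mathcal{D}$ a distribution on $Q$, and let $\hat g$ be a pseudo-Riemannian metric on $Q$ which is a $\mathcal{D}$-preserving modification of $g$ and whose restriction $\hat g|_{\mathcal{D}^{\hat g}\times\mathcal{D}^{\hat g}}$ to the $\hat g$-orthogonal complement $\mathcal{D}^{\hat g}$ of $\mathcal{D}$ is non-degenerate. Then the equations $$( * )\qquad \hat\Gamma^c_{ab}v^av^b=\Gamma^c_{ab}v^av^b\ \text{ for all } c,\qquad \hat\Gamma^i_{ab}v^av^b=0\ \text{ for all } i$$ (required for all $v^a$) are equivalent with the equations $$(A)\quad \hat g_{bk}R^k_{ac}v^av^b=0\ \text{ for all } c,$$ $$(B)\quad \hat g_{di}\Gamma^d_{ab}v^av^b=\big(g_{ki}\Gamma^k_{ab}+X_a(\hat g_{bi})-\hat g_{bk}R^k_{ai}\big)v^av^b\ \text{ for all } i$$ (required for all $v^a$), in the unknown restriction $\hat g|_{\mathcal{D}\times\mathcal{D}^g}=(\hat g_{ai})$. When written in terms of the functions $\theta_i=\hat g_{ai}v^a$ on $\mathcal{C}$, the algebraic condition $(A)$ and the PDE condition $(B)$ become, on $\mathcal{C}$, $$(A)\quad \theta_kR^k_{ac}v^a=0,\qquad (B)\quad \Gamma_{(L,\mathcal{D})}(\theta_i)+\theta_kR^k_{ia}v^a+\lambda_i=0.$$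
   Context: All objects are smooth and repeated indices are summed. $Q$ is an $n$-dimensional manifold, $\mathcal{D}$ has rank $m$, $\mathcal{D}^g$ is the $g$-orthogonal complement of $\mathcal{D}$. A globally defined frame $\{X_\alpha\}=\{X_a,X_i\}$ on $Q$ is fixed, with $\{X_a\}$ ($a,b,c,d,\ldots\in\{1,\dots,m\}$) spanning $\mathcal{D}$ and $\{X_i\}$ ($i,j,k\in\{1,\dots,n-m\}$) spanning $\mathcal{D}^g$. $[X_\alpha,X_\beta]=R^\gamma_{\alpha\beta}X_\gamma$; $g_{\alpha\beta}=g(X_\alpha,X_\beta)$ (so $g_{ai}=0$); $\hat g_{\alpha\beta}=\hat g(X_\alpha,X_\beta)$; $\nabla^g_{X_\alpha}X_\beta=\Gamma^\gamma_{\alpha\beta}X_\gamma$ and $\nabla^{\hat g}_{X_\alpha}X_\beta=\hat\Gamma^\gamma_{\alpha\beta}X_\gamma$ for the Levi-Civita connections of $g$ and $\hat g$. Quasi-velocities $v^\alpha=(v^a,v^i)$ are the functions on $TQ$ with $v_q=v^\alpha X_\alpha(q)$; $\mathcal{C}=\{v^i=0\}$ is $\mathcal{D}$ viewed as a submanifold of $TQ$. $X^C$, $X^V$ denote the complete and vertical lifts to $TQ$ of a vector field $X$ on $Q$. A symmetric $(0,2)$-tensor field $\hat g$ on $Q$ is a $\mathcal{D}$-preserving modification of $g$ if $\hat g|_{\mathcal{D}\times\mathcal{D}}=g|_{\mathcal{D}\times\mathcal{D}}$, i.e. $\hat g_{ab}=g_{ab}$. A pseudo-Riemannian metric is a non-degenerate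 symmetric $(0,2)$-tensor field. The nonholonomic vector field $\Gamma_{(L,\mathcal{D})}$ is the unique vector field on $\mathcal{C}$ of the form $v^aX_a^C+f^aX_a^V$ satisfying $\Gamma_{(L,\mathcal{D})}(X^V(L))-X^C(L)=0$ on $\mathcal{C}$ for all $X\in\mathrm{Sec}(\mathcal{D})$; one has $f^d=-\Gamma^d_{ab}v^av^b$. The multipliers are the functions $\lambda_i=\Gamma_{(L,\mathcal{D})}(X_i^V(L))-X_i^C(L)$ on $\mathcal{C}$. *)

theory Defs
  imports "HOL-Analysis.Analysis"
begin

section \<open>Smooth maps between open subsets of normed spaces\<close>

primrec Ck_on :: "nat \<Rightarrow> ('a::real_normed_vector \<Rightarrow> 'b::real_normed_vector) \<Rightarrow> 'a set \<Rightarrow> bool" where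
  "Ck_on 0 f S \<longleftrightarrow> continuous_on S f"
| "Ck_on (Suc k) f S \<longleftrightarrow>
     (\<forall>x\<in>S. f differentiable (at x)) \<and>
     (\<forall>h. Ck_on k (\<lambda>x. frechet_derivative f (at x) h) S)"

text \<open>Only used for open \<open>S\<close> and finite-dimensional domains, where this is the usual
  notion of a \<open>C\<^sup>\<infinity>\<close> map (all iterated directional derivatives exist and are continuous).\<close>

definition smooth_on :: "'a::real_normed_vector set \<Rightarrow> ('a \<Rightarrow> 'b::real_normed_vector) \<Rightarrow> bool" where
  "smooth_on S f \<longleftrightarrow> (\<forall>k. Ck_on k f S)"


section \<open>Smooth manifolds\<close>

text \<open>A chart is a pair of a domain \<open>U\<close> and a map \<open>\<phi>\<close>, of which only the values on \<open>U\<close> matter.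
  The manifold is the union of the domains of an atlas, with the topology determined by the
  atlas; its dimension is that of the model space \<open>'e\<close>.\<close>

type_synonym ('p, 'e) chart = "'p set \<times> ('p \<Rightarrow> 'e)"
type_synonym ('p, 'e) atlas = "('p, 'e) chart set"

definition pts :: "('p, 'e) atlas \<Rightarrow> 'p set" where
  "pts A = \<Union> (fst ` A)"

definition atlas_open :: "('p, 'e::euclidean_space) atlas \<Rightarrow> 'p set \<Rightarrow> bool" where
  "atlas_open A W \<longleftrightarrow> W \<subseteq> pts A \<and> (\<forall>(U, \<phi>)\<in>A. open (\<phi> ` (U \<inter> W)))"

definition smooth_atlas :: "('p, 'e::euclidean_space) atlas \<Rightarrow> bool" where
  "smooth_atlas A \<longleftrightarrow>
     (\<forall>(U, \<phi>)\<in>A. inj_on \<phi> U) \<and>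
     (\<forall>(U, \<phi>)\<in>A. \<forall>(V, \<psi>)\<in>A.
        open (\<phi> ` (U \<inter> V)) \<and> smooth_on (\<phi> ` (U \<inter> V)) (\<psi> \<circ> inv_into U \<phi>))"

lemma istopology_atlas_open:
  assumes "smooth_atlas A"
  shows "istopology (atlas_open A)"
  unfolding istopology_def
proof (intro conjI allI impI)
  fix S T assume "atlas_open A S" "atlas_open A T"
  moreover have "\<phi> ` (U \<inter> (S \<inter> T)) = \<phi> ` (U \<inter> S) \<inter> \<phi> ` (U \<inter> T)" if "(U, \<phi>) \<in> A" for U \<phi>
  proof -
    have "inj_on \<phi> U"
      using assms that by (auto simp: smooth_atlas_def)
    then show ?thesis
      by (auto simp: inj_on_def)
  qed
  ultimately show "atlas_open A (S \<inter> T)"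
    by (fastforce simp: atlas_open_def intro!: open_Int)
next
  fix K assume K: "\<forall>S\<in>K. atlas_open A S"
  have "open (\<phi> ` (U \<inter> \<Union>K))" if "(U, \<phi>) \<in> A" for U \<phi>
  proof -
    have "\<phi> ` (U \<inter> \<Union>K) = (\<Union>S\<in>K. \<phi> ` (U \<inter> S))"
      by auto
    then show ?thesis
      using K that by (force simp: atlas_open_def intro!: open_UN)
  qed
  then show "atlas_open A (\<Union>K)"
    using K by (auto simp: atlas_open_def)
qed

definition smooth_manifold :: "('p, 'e::euclidean_space) atlas \<Rightarrow> bool" where
  "smooth_manifold A \<longleftrightarrow> smooth_atlas A \<and>
     Hausdorff_space (topology (atlas_open A)) \<and> second_countable (topology (atlas_open A))"

definition near :: "('p, 'e::euclidean_space) atlas \<Rightarrow> 'p \<Rightarrow> ('p \<Rightarrow> bool) \<Rightarrow> bool" where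
  "near A p P \<longleftrightarrow> (\<exists>W. atlas_open A W \<and> p \<in> W \<and> (\<forall>x\<in>W. P x))"

definition smooth_fun :: "('p, 'e::euclidean_space) atlas \<Rightarrow> 'p set \<Rightarrow> ('p \<Rightarrow> real) \<Rightarrow> bool" where
  "smooth_fun A W f \<longleftrightarrow> (\<forall>(U, \<phi>)\<in>A. smooth_on (\<phi> ` (U \<inter> W)) (f \<circ> inv_into U \<phi>))"

definition smooth_near :: "('p, 'e::euclidean_space) atlas \<Rightarrow> 'p \<Rightarrow> ('p \<Rightarrow> real) \<Rightarrow> bool" where
  "smooth_near A p f \<longleftrightarrow> (\<exists>W. atlas_open A W \<and> p \<in> W \<and> smooth_fun A W f)"


section \<open>Tangent vectors and vector fields\<close>

text \<open>A tangent vector at \<open>p\<close> is represented by its action on the functions which are smooth near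
  \<open>p\<close>.  To make equality of functionals the equality of tangent vectors, it is fixed to be
  \<open>0\<close> on all other functions.\<close>

type_synonym 'p tvec = "('p \<Rightarrow> real) \<Rightarrow> real"

definition chart_vec ::
    "('p, 'e::euclidean_space) atlas \<Rightarrow> ('p, 'e) chart \<Rightarrow> 'p \<Rightarrow> 'e \<Rightarrow> 'p tvec" where
  "chart_vec A c p w = (\<lambda>f. if smooth_near A p f
     then frechet_derivative (f \<circ> inv_into (fst c) (snd c)) (at (snd c p)) w else 0)"

definition tangent_space :: "('p, 'e::euclidean_space) atlas \<Rightarrow> 'p \<Rightarrow> 'p tvec set" where
  "tangent_space A p = {chart_vec A c p w | c w. c \<in> A \<and> p \<in> fst c}"

text \<open>The components of a tangent vector in a chart, obtained by applying it to the coordinate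
  functions.\<close>

definition vec_coords :: "('p \<Rightarrow> 'e::euclidean_space) \<Rightarrow> 'p tvec \<Rightarrow> 'e" where
  "vec_coords \<phi> u = (\<Sum>b\<in>Basis. u (\<lambda>x. \<phi> x \<bullet> b) *\<^sub>R b)"

type_synonym 'p vfield = "'p \<Rightarrow> 'p tvec"

definition local_rep :: "('p, 'e::euclidean_space) chart \<Rightarrow> 'p vfield \<Rightarrow> 'e \<Rightarrow> 'e" where
  "local_rep c X = (\<lambda>x. vec_coords (snd c) (X (inv_into (fst c) (snd c) x)))"

definition vector_field :: "('p, 'e::euclidean_space) atlas \<Rightarrow> 'p vfield \<Rightarrow> bool" where
  "vector_field A X \<longleftrightarrow> (\<forall>p\<in>pts A. X p \<in> tangent_space A p) \<and>
     (\<forall>(U, \<phi>)\<in>A. smooth_on (\<phi> ` U) (local_rep (U, \<phi>) X))"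

definition lie_bracket ::
    "('p, 'e::euclidean_space) atlas \<Rightarrow> 'p vfield \<Rightarrow> 'p vfield \<Rightarrow> 'p vfield" where
  "lie_bracket A X Y = (\<lambda>p f. if smooth_near A p f
     then X p (\<lambda>x. Y x f) - Y p (\<lambda>x. X x f) else 0)"


section \<open>Metrics and Levi-Civita connections\<close>

type_synonym 'p tensor2 = "'p \<Rightarrow> 'p tvec \<Rightarrow> 'p tvec \<Rightarrow> real"

definition sym_tensor_field :: "('p, 'e::euclidean_space) atlas \<Rightarrow> 'p tensor2 \<Rightarrow> bool" where
  "sym_tensor_field A g \<longleftrightarrow>
     (\<forall>p\<in>pts A. \<forall>u\<in>tangent_space A p. \<forall>v\<in>tangent_space A p. \<forall>w\<in>tangent_space A p. \<forall>r s.
        g p u v = g p v u \<and>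
        g p (\<lambda>f. r * u f + s * v f) w = r * g p u w + s * g p v w) \<and>
     (\<forall>X Y. vector_field A X \<longrightarrow> vector_field A Y \<longrightarrow>
        smooth_fun A (pts A) (\<lambda>p. g p (X p) (Y p)))"

definition nondegenerate_on :: "('p tvec \<Rightarrow> 'p tvec \<Rightarrow> real) \<Rightarrow> 'p tvec set \<Rightarrow> bool" where
  "nondegenerate_on b S \<longleftrightarrow> (\<forall>u\<in>S. (\<forall>v\<in>S. b u v = 0) \<longrightarrow> u = (\<lambda>f. 0))"

definition riemannian_metric :: "('p, 'e::euclidean_space) atlas \<Rightarrow> 'p tensor2 \<Rightarrow> bool" where
  "riemannian_metric A g \<longleftrightarrow> sym_tensor_field A g \<and>
     (\<forall>p\<in>pts A. \<forall>u\<in>tangent_space A p. u \<noteq> (\<lambda>f. 0) \<longrightarrow> g p u u > 0)"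

definition pseudo_riemannian_metric :: "('p, 'e::euclidean_space) atlas \<Rightarrow> 'p tensor2 \<Rightarrow> bool" where
  "pseudo_riemannian_metric A g \<longleftrightarrow> sym_tensor_field A g \<and>
     (\<forall>p\<in>pts A. nondegenerate_on (g p) (tangent_space A p))"

definition levi_civita ::
    "('p, 'e::euclidean_space) atlas \<Rightarrow> 'p tensor2 \<Rightarrow> ('p vfield \<Rightarrow> 'p vfield \<Rightarrow> 'p vfield) \<Rightarrow> bool"
where
  "levi_civita A g nab \<longleftrightarrow>
     (\<forall>X Y. vector_field A X \<longrightarrow> vector_field A Y \<longrightarrow> vector_field A (nab X Y)) \<and>
     (\<forall>X Y Z h k. vector_field A X \<longrightarrow> vector_field A Y \<longrightarrow> vector_field A Z \<longrightarrow>
        smooth_fun A (pts A) h \<longrightarrow> smooth_fun A (pts A) k \<longrightarrow>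
        (\<forall>p\<in>pts A.
           nab (\<lambda>q f. h q * X q f + k q * Y q f) Z p = (\<lambda>f. h p * nab X Z p f + k p * nab Y Z p f) \<and>
           nab X (\<lambda>q f. Y q f + Z q f) p = (\<lambda>f. nab X Y p f + nab X Z p f) \<and>
           nab X (\<lambda>q f. h q * Y q f) p = (\<lambda>f. X p h * Y p f + h p * nab X Y p f) \<and>
           (\<lambda>f. nab X Y p f - nab Y X p f) = lie_bracket A X Y p \<and>
           X p (\<lambda>q. g q (Y q) (Z q)) = g p (nab X Y p) (Z p) + g p (Y p) (nab X Z p)))"


section \<open>Distributions and frames\<close>

definition orth_compl ::
    "('p, 'e::euclidean_space) atlas \<Rightarrow> 'p tensor2 \<Rightarrow> ('p \<Rightarrow> 'p tvec set) \<Rightarrow> 'p \<Rightarrow> 'p tvec set" where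
  "orth_compl A g D p = {u \<in> tangent_space A p. \<forall>v\<in>D p. g p u v = 0}"

definition lin_comb :: "nat set \<Rightarrow> (nat \<Rightarrow> 'p tvec) \<Rightarrow> (nat \<Rightarrow> real) \<Rightarrow> 'p tvec" where
  "lin_comb I e v = (\<lambda>f. \<Sum>\<alpha>\<in>I. v \<alpha> * e \<alpha> f)"

definition global_frame ::
    "('p, 'e::euclidean_space) atlas \<Rightarrow> nat \<Rightarrow> (nat \<Rightarrow> 'p vfield) \<Rightarrow> bool" where
  "global_frame A n X \<longleftrightarrow> (\<forall>\<alpha>\<in>{1..n}. vector_field A (X \<alpha>)) \<and>
     (\<forall>p\<in>pts A. \<forall>u\<in>tangent_space A p.
        \<exists>!v. (\<forall>\<alpha>. \<alpha> \<notin> {1..n} \<longrightarrow> v \<alpha> = 0) \<and> u = lin_comb {1..n} (\<lambda>\<alpha>. X \<alpha> p) v)"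

definition frame_comp :: "nat \<Rightarrow> (nat \<Rightarrow> 'p vfield) \<Rightarrow> nat \<Rightarrow> 'p \<times> 'p tvec \<Rightarrow> real" where
  "frame_comp n X \<alpha> = (\<lambda>(p, u). (THE v. (\<forall>\<beta>. \<beta> \<notin> {1..n} \<longrightarrow> v \<beta> = 0) \<and>
     u = lin_comb {1..n} (\<lambda>\<beta>. X \<beta> p) v) \<alpha>)"

definition preserving_modification ::
    "('p, 'e::euclidean_space) atlas \<Rightarrow> ('p \<Rightarrow> 'p tvec set) \<Rightarrow> 'p tensor2 \<Rightarrow> 'p tensor2 \<Rightarrow> bool" where
  "preserving_modification A D g gh \<longleftrightarrow> sym_tensor_field A gh \<and>
     (\<forall>p\<in>pts A. \<forall>u\<in>D p. \<forall>v\<in>D p. gh p u v = g p u v)"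

text \<open>In the next two definitions the upper index comes first: \<open>R\<^sup>\<gamma>\<^sub>\<alpha>\<^sub>\<beta>\<close> and \<open>\<Gamma>\<^sup>\<gamma>\<^sub>\<alpha>\<^sub>\<beta>\<close> are
  \<open>structure_fun A n X \<gamma> \<alpha> \<beta>\<close> and \<open>christoffel n X nab \<gamma> \<alpha> \<beta>\<close>.\<close>

definition structure_fun ::
    "('p, 'e::euclidean_space) atlas \<Rightarrow> nat \<Rightarrow> (nat \<Rightarrow> 'p vfield) \<Rightarrow> nat \<Rightarrow> nat \<Rightarrow> nat \<Rightarrow> 'p \<Rightarrow> real" where
  "structure_fun A n X \<gamma> \<alpha> \<beta> p = frame_comp n X \<gamma> (p, lie_bracket A (X \<alpha>) (X \<beta>) p)"

definition christoffel ::
    "nat \<Rightarrow> (nat \<Rightarrow> 'p vfield) \<Rightarrow> ('p vfield \<Rightarrow> 'p vfield \<Rightarrow> 'p vfield) \<Rightarrow>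
     nat \<Rightarrow> nat \<Rightarrow> nat \<Rightarrow> 'p \<Rightarrow> real" where
  "christoffel n X nab \<gamma> \<alpha> \<beta> p = frame_comp n X \<gamma> (p, nab (X \<alpha>) (X \<beta>) p)"


section \<open>The tangent bundle, and lifts of vector fields\<close>

definition tangent_chart ::
    "('p, 'e::euclidean_space) atlas \<Rightarrow> ('p, 'e) chart \<Rightarrow> ('p \<times> 'p tvec, 'e \<times> 'e) chart" where
  "tangent_chart A c = ({(p, u). p \<in> fst c \<and> u \<in> tangent_space A p},
     \<lambda>(p, u). (snd c p, vec_coords (snd c) u))"

definition tangent_atlas ::
    "('p, 'e::euclidean_space) atlas \<Rightarrow> ('p \<times> 'p tvec, 'e \<times> 'e) atlas" where
  "tangent_atlas A = tangent_chart A ` A"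

definition vertical_lift ::
    "('p, 'e::euclidean_space) atlas \<Rightarrow> 'p vfield \<Rightarrow> ('p \<times> 'p tvec) vfield" where
  "vertical_lift A X = (\<lambda>(p, u) F. if smooth_near (tangent_atlas A) (p, u) F
     then deriv (\<lambda>t. F (p, \<lambda>f. u f + t * X p f)) 0 else 0)"

text \<open>In the coordinates \<open>(x\<^sup>k, w\<^sup>k)\<close> which a chart induces on the tangent bundle, the complete lift
  of \<open>X\<^sup>k \<partial>/\<partial>x\<^sup>k\<close> is \<open>X\<^sup>k \<partial>/\<partial>x\<^sup>k + w\<^sup>j (\<partial>X\<^sup>k/\<partial>x\<^sup>j) \<partial>/\<partial>w\<^sup>k\<close>, whatever the chart.\<close>

definition complete_lift ::
    "('p, 'e::euclidean_space) atlas \<Rightarrow> 'p vfield \<Rightarrow> ('p \<times> 'p tvec) vfield" where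
  "complete_lift A X = (\<lambda>(p, u).
     let c = (SOME c. c \<in> A \<and> p \<in> fst c) in
     chart_vec (tangent_atlas A) (tangent_chart A c) (p, u)
       (local_rep c X (snd c p),
        frechet_derivative (local_rep c X) (at (snd c p)) (vec_coords (snd c) u)))"


section \<open>Vector fields on a submanifold\<close>

text \<open>Functions on an embedded submanifold \<open>C\<close> are functions on the ambient manifold of which only
  the values on \<open>C\<close> matter; they are smooth if they extend locally to smooth functions.
  Tangent vectors to \<open>C\<close> are the ambient tangent vectors annihilating the functions that vanish
  on \<open>C\<close>; so their action on a function on \<open>C\<close> does not depend on the extension.\<close>

definition local_ext ::
    "('p, 'e::euclidean_space) atlas \<Rightarrow> 'p set \<Rightarrow> 'p \<Rightarrow> ('p \<Rightarrow> real) \<Rightarrow> ('p \<Rightarrow> real) \<Rightarrow> bool" where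
  "local_ext A C p h H \<longleftrightarrow> smooth_near A p H \<and> near A p (\<lambda>x. x \<in> C \<longrightarrow> H x = h x)"

definition sub_smooth :: "('p, 'e::euclidean_space) atlas \<Rightarrow> 'p set \<Rightarrow> ('p \<Rightarrow> real) \<Rightarrow> bool" where
  "sub_smooth A C h \<longleftrightarrow> (\<forall>p\<in>C. \<exists>H. local_ext A C p h H)"

definition sub_tangent_space ::
    "('p, 'e::euclidean_space) atlas \<Rightarrow> 'p set \<Rightarrow> 'p \<Rightarrow> 'p tvec set" where
  "sub_tangent_space A C p = {u \<in> tangent_space A p. \<forall>H. local_ext A C p (\<lambda>x. 0) H \<longrightarrow> u H = 0}"

definition sub_apply ::
    "('p, 'e::euclidean_space) atlas \<Rightarrow> 'p set \<Rightarrow> 'p vfield \<Rightarrow> ('p \<Rightarrow> real) \<Rightarrow> 'p \<Rightarrow> real" where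
  "sub_apply A C Z h p = (THE r. \<exists>H. local_ext A C p h H \<and> r = Z p H)"


section \<open>The nonholonomic vector field\<close>

definition kinetic :: "'p tensor2 \<Rightarrow> 'p \<times> 'p tvec \<Rightarrow> real" where
  "kinetic g = (\<lambda>(p, u). g p u u / 2)"

definition dist_set ::
    "('p, 'e::euclidean_space) atlas \<Rightarrow> ('p \<Rightarrow> 'p tvec set) \<Rightarrow> ('p \<times> 'p tvec) set" where
  "dist_set A D = {(p, u). p \<in> pts A \<and> u \<in> D p}"

definition nonholonomic_field ::
    "('p, 'e::euclidean_space) atlas \<Rightarrow> nat \<Rightarrow> nat \<Rightarrow> (nat \<Rightarrow> 'p vfield) \<Rightarrow> ('p \<Rightarrow> 'p tvec set) \<Rightarrow>
     ('p \<times> 'p tvec \<Rightarrow> real) \<Rightarrow> ('p \<times> 'p tvec) vfield \<Rightarrow> bool" where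
  "nonholonomic_field A m n X D L Z \<longleftrightarrow>
     (\<forall>x\<in>dist_set A D. Z x \<in> sub_tangent_space (tangent_atlas A) (dist_set A D) x) \<and>
     (\<exists>F. (\<forall>a\<in>{1..m}. sub_smooth (tangent_atlas A) (dist_set A D) (F a)) \<and>
        (\<forall>x\<in>dist_set A D. Z x = (\<lambda>H. \<Sum>a=1..m.
           frame_comp n X a x * complete_lift A (X a) x H + F a x * vertical_lift A (X a) x H))) \<and>
     (\<forall>Y. vector_field A Y \<and> (\<forall>p\<in>pts A. Y p \<in> D p) \<longrightarrow>
        (\<forall>x\<in>dist_set A D.
           sub_apply (tangent_atlas A) (dist_set A D) Z (\<lambda>y. vertical_lift A Y y L) x
             - complete_lift A Y x L = 0))"

definition multiplier ::
    "('p, 'e::euclidean_space) atlas \<Rightarrow> ('p \<Rightarrow> 'p tvec set) \<Rightarrow> (nat \<Rightarrow> 'p vfield) \<Rightarrow>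
     ('p \<times> 'p tvec \<Rightarrow> real) \<Rightarrow> ('p \<times> 'p tvec) vfield \<Rightarrow> nat \<Rightarrow> 'p \<times> 'p tvec \<Rightarrow> real" where
  "multiplier A D X L Z i x =
     sub_apply (tangent_atlas A) (dist_set A D) Z (\<lambda>y. vertical_lift A (X i) y L) x
       - complete_lift A (X i) x L"

end

theory Submission
  imports Defs "Jordan_Normal_Form.Determinant"
begin

text \<open>
  Fix a point \<open>p\<close> and numbers \<open>v\<^sup>a\<close>, and let \<open>V = v\<^sup>a X\<^sub>a\<close> be the section of the distribution with
  these constant frame components; then \<open>\<nabla>\<^sub>V V = \<Gamma>\<^sup>\<gamma>\<^sub>a\<^sub>b v\<^sup>a v\<^sup>b X\<^sub>\<gamma>\<close>.  For the Levi-Civita connection of a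
  metric \<open>s\<close> one has \<open>s(\<nabla>\<^sub>V V, Y) = V(s(V, Y)) - Y(s(V, V)/2) - s(V, [V, Y])\<close> (lemma
  \<open>acceleration_koszul\<close>).  Compare this identity for the modified metric \<open>gh\<close> and for \<open>g\<close>, with
  \<open>Y = X\<^sub>\<delta>\<close>.  The middle terms cancel because both metrics give \<open>V\<close> the same kinetic energy.
  The first terms agree if \<open>Y\<close> lies in the distribution, and if \<open>Y = X\<^sub>i\<close> is orthogonal to it, then that
  of \<open>g\<close> vanishes and that of \<open>gh\<close> is \<open>X\<^sub>a(gh\<^sub>b\<^sub>i) v\<^sup>a v\<^sup>b\<close>.  The last terms differ by
  \<open>gh\<^sub>b\<^sub>k R\<^sup>k\<^sub>a\<^sub>\<delta> v\<^sup>a v\<^sup>b\<close>.  So let \<open>W\<close> be the \<open>gh\<close>-acceleration of \<open>V\<close> minus the part of its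
  \<open>g\<close>-acceleration that is tangent to the distribution.  The number \<open>gh(W, X\<^sub>c)\<close> is minus the left side
  of (A), and \<open>gh(W, X\<^sub>i)\<close> is the right side of (B) minus its left side.  As \<open>gh\<close> is
  non-degenerate, (A) and (B) hold iff \<open>W = 0\<close>, which is what the starred equations say
  (lemma \<open>accelerations_agree_iff\<close>).

  For the form of (A) and (B) on the distribution, the point \<open>u\<close> of the tangent bundle is written as
  \<open>V(p)\<close> with \<open>V\<close> as above.  The differential of the section \<open>V\<close> maps \<open>Y(p)\<close> to the difference of
  the complete lift of \<open>Y\<close> and the vertical lift of \<open>[V, Y]\<close> at \<open>V(p)\<close>, whence
  \<open>Y\<^sup>C(F) = Y(F \<circ> V) + [V, Y]\<^sup>V(F)\<close> (lemma \<open>complete_lift_section\<close>).  This turns every lift into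
  a derivative on the base.  If the nonholonomic field is \<open>v\<^sup>a X\<^sub>a\<^sup>C + f\<^sup>a X\<^sub>a\<^sup>V\<close>, it maps
  the fibrewise linear function \<open>s(\<cdot>, Y)\<close> to \<open>V(s(V, Y)) + f\<^sup>a s(X\<^sub>a, Y)\<close>, and its Euler-Lagrange
  expression along \<open>Y\<close> is \<open>g(\<nabla>\<^sub>V V + f\<^sup>a X\<^sub>a, Y)\<close>.  Sections \<open>Y\<close> of the distribution determine
  \<open>f\<^sup>d = - \<Gamma>\<^sup>d\<^sub>a\<^sub>b v\<^sup>a v\<^sup>b\<close>, the choice \<open>Y = X\<^sub>i\<close> gives the multiplier \<open>\<lambda>\<^sub>i\<close>, and \<open>s = gh\<close> gives the
  derivative of \<open>\<theta>\<^sub>i\<close>.  Together with \<open>\<theta>\<^sub>k R\<^sup>k\<^sub>i\<^sub>a v\<^sup>a\<close> they add up to the difference of the two sides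
  of (B).

  Tangent vectors take the value \<open>0\<close> on functions that are not smooth near the point, so smoothness has to
  be established for every function that is differentiated.  The essential case is that of the
  quasi-velocities on the tangent bundle (lemma \<open>smooth_frame_comp\<close>).  In a chart they solve a
  linear system whose matrix depends smoothly on the point, so Cramer's rule makes them smooth.
\<close>

no_notation scalar_prod (infix "\<bullet>" 70)

section \<open>Calculus of smooth maps\<close>

lemma Ck_on_cong:
  assumes "open S" "\<And>x. x \<in> S \<Longrightarrow> f x = g x" "Ck_on k f S"
  shows "Ck_on k g S"
  using assms(2,3)
proof (induction k arbitrary: f g)
  case 0
  then show ?case
    using continuous_on_cong by force
next
  case (Suc k)
  have d: "f differentiable (at x)" if "x \<in> S" for x
    using Suc.prems(2) that by simp
  have fd: "frechet_derivative f (at x) = frechet_derivative g (at x)" if "x \<in> S" for x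
    using frechet_derivative_transform_within_open[OF d[OF that] assms(1) that Suc.prems(1)] .
  have "g differentiable (at x)" if "x \<in> S" for x
    using d[OF that] has_derivative_transform_within_open[of f _ x UNIV S g] assms(1) that Suc.prems(1)
    unfolding differentiable_def by blast
  moreover have "Ck_on k (\<lambda>x. frechet_derivative g (at x) h) S" for h
    by (rule Suc.IH[of "\<lambda>x. frechet_derivative f (at x) h"]) (use fd Suc.prems(2) in auto)
  ultimately show ?case
    by simp
qed

text \<open>The recursive definition of \<open>Ck_on\<close> refers to the derivative chosen by
  \<open>frechet_derivative\<close>; this form admits any explicit formula for it, which lets every closure
  property below follow by induction from the corresponding differentiation rule.\<close>
lemma Ck_on_SucI:
  assumes "open S" "\<And>x. x \<in> S \<Longrightarrow> (f has_derivative f' x) (at x)"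
    and "\<And>h. Ck_on k (\<lambda>x. f' x h) S"
  shows "Ck_on (Suc k) f S"
proof -
  have "f' x = frechet_derivative f (at x)" if "x \<in> S" for x
    using frechet_derivative_at[OF assms(2)[OF that]] .
  then have "Ck_on k (\<lambda>x. frechet_derivative f (at x) h) S" for h
    by (intro Ck_on_cong[OF assms(1) _ assms(3)[of h]]) auto
  with assms(2) show ?thesis
    by (auto simp: differentiable_def)
qed

lemma Ck_on_SucD:
  assumes "Ck_on (Suc k) f S"
  shows "x \<in> S \<Longrightarrow> (f has_derivative frechet_derivative f (at x)) (at x)"
    and "Ck_on k (\<lambda>x. frechet_derivative f (at x) h) S"
  using assms by (auto simp: frechet_derivative_works)

lemma Ck_on_Suc_imp:
  "Ck_on (Suc k) f S \<Longrightarrow> Ck_on k f S"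
proof (induction k arbitrary: f)
  case 0
  then show ?case
    by (auto intro!: continuous_at_imp_continuous_on differentiable_imp_continuous_within)
next
  case (Suc k)
  then show ?case
    by (metis Ck_on.simps(2))
qed

lemma Ck_on_const: "Ck_on k (\<lambda>x. c) S"
  by (induction k arbitrary: c) auto

lemma Ck_on_bounded_linear:
  assumes "bounded_linear l" "open S"
  shows "Ck_on k l S"
proof (cases k)
  case 0
  then show ?thesis
    using assms by (simp add: linear_continuous_on)
next
  case (Suc j)
  show ?thesis
    unfolding Suc
    by (rule Ck_on_SucI[where f' = "\<lambda>x. l"])
       (use assms in \<open>auto intro: bounded_linear_imp_has_derivative Ck_on_const\<close>)
qed

lemma Ck_on_add:
  assumes "open S"
  shows "Ck_on k f S \<Longrightarrow> Ck_on k g S \<Longrightarrow> Ck_on k (\<lambda>x. f x + g x) S"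
proof (induction k arbitrary: f g)
  case 0
  then show ?case by (auto intro: continuous_on_add)
next
  case (Suc k)
  show ?case
    by (rule Ck_on_SucI[OF assms has_derivative_add[OF Ck_on_SucD(1)[OF Suc.prems(1)]
            Ck_on_SucD(1)[OF Suc.prems(2)]]])
       (auto intro: Suc.IH Ck_on_SucD(2)[OF Suc.prems(1)] Ck_on_SucD(2)[OF Suc.prems(2)])
qed

lemma Ck_on_bilinear:
  assumes "open S" "bounded_bilinear p"
  shows "Ck_on k f S \<Longrightarrow> Ck_on k g S \<Longrightarrow> Ck_on k (\<lambda>x. p (f x) (g x)) S"
proof (induction k arbitrary: f g)
  case 0
  then show ?case using bounded_bilinear.continuous_on[OF assms(2)] by auto
next
  case (Suc k)
  show ?case
    by (rule Ck_on_SucI[OF assms(1) bounded_bilinear.FDERIV[OF assms(2)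
            Ck_on_SucD(1)[OF Suc.prems(1)] Ck_on_SucD(1)[OF Suc.prems(2)]]])
       (auto intro!: Ck_on_add assms(1) Suc.IH Ck_on_Suc_imp[OF Suc.prems(1)]
          Ck_on_Suc_imp[OF Suc.prems(2)] Ck_on_SucD(2)[OF Suc.prems(1)] Ck_on_SucD(2)[OF Suc.prems(2)])
qed

lemma Ck_on_sum:
  assumes "open S" "\<And>i. i \<in> I \<Longrightarrow> Ck_on k (f i) S"
  shows "Ck_on k (\<lambda>x. \<Sum>i\<in>I. f i x) S"
  using assms(2)
  by (induction I rule: infinite_finite_induct)
     (auto intro: Ck_on_const Ck_on_add[OF assms(1)])

text \<open>By the chain rule, the derivative of the composition in direction \<open>h\<close> is the derivative of \<open>f\<close>
  in a direction that depends on the point.  Expanding this direction in the finite basis turns it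
  into a sum of products of functions that are \<open>C\<^sup>k\<close> by induction.\<close>
lemma Ck_on_compose:
  fixes f :: "'b::euclidean_space \<Rightarrow> 'c::real_normed_vector" and g :: "'a::real_normed_vector \<Rightarrow> 'b"
  assumes "open S" "open T" "g ` S \<subseteq> T"
  shows "Ck_on k f T \<Longrightarrow> Ck_on k g S \<Longrightarrow> Ck_on k (\<lambda>x. f (g x)) S"
proof (induction k arbitrary: f)
  case 0
  then show ?case
    using continuous_on_compose2[OF _ _ assms(3)] by auto
next
  case (Suc k)
  let ?f' = "\<lambda>x. frechet_derivative f (at x)" and ?g' = "\<lambda>x. frechet_derivative g (at x)"
  have fd: "(f has_derivative ?f' (g x)) (at (g x))" if "x \<in> S" for x
    using Ck_on_SucD(1)[OF Suc.prems(1)] that assms(3) by auto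
  have gd: "(g has_derivative ?g' x) (at x)" if "x \<in> S" for x
    using Ck_on_SucD(1)[OF Suc.prems(2)] that by auto
  have lin: "?f' (g x) (?g' x h) = (\<Sum>b\<in>Basis. (?g' x h \<bullet> b) *\<^sub>R ?f' (g x) b)" if "x \<in> S" for x h
  proof -
    have l: "linear (?f' (g x))"
      using fd[OF that] has_derivative_linear by blast
    have "?f' (g x) (?g' x h) = ?f' (g x) (\<Sum>b\<in>Basis. (?g' x h \<bullet> b) *\<^sub>R b)"
      by (simp add: euclidean_representation)
    also have "\<dots> = (\<Sum>b\<in>Basis. (?g' x h \<bullet> b) *\<^sub>R ?f' (g x) b)"
      by (simp add: linear_sum[OF l] linear_scale[OF l])
    finally show ?thesis .
  qed
  show ?case
  proof (rule Ck_on_SucI[OF assms(1)])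
    fix x assume "x \<in> S"
    show "((\<lambda>x. f (g x)) has_derivative
        (\<lambda>h. \<Sum>b\<in>Basis. (?g' x h \<bullet> b) *\<^sub>R ?f' (g x) b)) (at x)"
      using has_derivative_compose[OF gd[OF \<open>x \<in> S\<close>] fd[OF \<open>x \<in> S\<close>]]
      by (simp add: lin[OF \<open>x \<in> S\<close>])
  next
    fix h
    have "Ck_on k (\<lambda>x. ?g' x h \<bullet> b) S" for b
      by (intro Ck_on_bilinear[OF assms(1) bounded_bilinear_inner] Ck_on_const
          Ck_on_SucD(2)[OF Suc.prems(2)])
    moreover have "Ck_on k (\<lambda>x. ?f' (g x) b) S" for b
      by (rule Suc.IH[OF Ck_on_SucD(2)[OF Suc.prems(1)] Ck_on_Suc_imp[OF Suc.prems(2)]])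
    ultimately show "Ck_on k (\<lambda>x. \<Sum>b\<in>Basis. (?g' x h \<bullet> b) *\<^sub>R ?f' (g x) b) S"
      by (intro Ck_on_sum[OF assms(1)] Ck_on_bilinear[OF assms(1) bounded_bilinear_scaleR])
  qed
qed

lemma Ck_on_inverse:
  fixes f :: "'a::real_normed_vector \<Rightarrow> real"
  assumes "open S" "\<And>x. x \<in> S \<Longrightarrow> f x \<noteq> 0"
  shows "Ck_on k f S \<Longrightarrow> Ck_on k (\<lambda>x. inverse (f x)) S"
proof (induction k)
  case 0
  then show ?case using assms(2) by (auto intro: continuous_on_inverse)
next
  case (Suc k)
  note mult = Ck_on_bilinear[OF assms(1) bounded_bilinear_mult]
  let ?f' = "\<lambda>x. frechet_derivative f (at x)"
  have IH: "Ck_on k (\<lambda>x. inverse (f x)) S"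
    by (rule Suc.IH[OF Ck_on_Suc_imp[OF Suc.prems]])
  show ?case
  proof (rule Ck_on_SucI[OF assms(1)])
    fix x assume "x \<in> S"
    show "((\<lambda>x. inverse (f x)) has_derivative
        (\<lambda>h. (- 1) * ((inverse (f x) * ?f' x h) * inverse (f x)))) (at x)"
      using Deriv.has_derivative_inverse[OF assms(2)[OF \<open>x \<in> S\<close>] Ck_on_SucD(1)[OF Suc.prems \<open>x \<in> S\<close>]]
      by simp
  next
    fix h
    show "Ck_on k (\<lambda>x. (- 1) * ((inverse (f x) * ?f' x h) * inverse (f x))) S"
      by (intro mult IH Ck_on_const Ck_on_SucD(2)[OF Suc.prems])
  qed
qed

lemma smooth_on_cong:
  "open S \<Longrightarrow> (\<And>x. x \<in> S \<Longrightarrow> f x = g x) \<Longrightarrow> smooth_on S f \<Longrightarrow> smooth_on S g"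
  unfolding smooth_on_def using Ck_on_cong by blast

lemma smooth_on_subset: "smooth_on S f \<Longrightarrow> T \<subseteq> S \<Longrightarrow> smooth_on T f"
proof -
  have "Ck_on k f S \<Longrightarrow> T \<subseteq> S \<Longrightarrow> Ck_on k f T" for k
    by (induction k arbitrary: f) (auto intro: continuous_on_subset)
  then show "smooth_on S f \<Longrightarrow> T \<subseteq> S \<Longrightarrow> smooth_on T f"
    by (auto simp: smooth_on_def)
qed

lemma smooth_on_differentiable: "smooth_on S f \<Longrightarrow> x \<in> S \<Longrightarrow> f differentiable (at x)"
  unfolding smooth_on_def by (metis Ck_on.simps(2))

lemma smooth_on_const: "smooth_on S (\<lambda>x. c)"
  by (simp add: smooth_on_def Ck_on_const)

lemma smooth_on_bounded_linear: "bounded_linear l \<Longrightarrow> open S \<Longrightarrow> smooth_on S l"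
  by (simp add: smooth_on_def Ck_on_bounded_linear)

lemma smooth_on_add:
  "open S \<Longrightarrow> smooth_on S f \<Longrightarrow> smooth_on S g \<Longrightarrow> smooth_on S (\<lambda>x. f x + g x)"
  by (simp add: smooth_on_def Ck_on_add)

lemma smooth_on_mult:
  fixes f g :: "_ \<Rightarrow> real"
  shows "open S \<Longrightarrow> smooth_on S f \<Longrightarrow> smooth_on S g \<Longrightarrow> smooth_on S (\<lambda>x. f x * g x)"
  by (simp add: smooth_on_def Ck_on_bilinear[OF _ bounded_bilinear_mult])

lemma smooth_on_inner:
  "open S \<Longrightarrow> smooth_on S f \<Longrightarrow> smooth_on S (\<lambda>x. f x \<bullet> b)"
  by (simp add: smooth_on_def Ck_on_bilinear[OF _ bounded_bilinear_inner] Ck_on_const)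

lemma smooth_on_sum:
  "open S \<Longrightarrow> (\<And>i. i \<in> I \<Longrightarrow> smooth_on S (f i)) \<Longrightarrow> smooth_on S (\<lambda>x. \<Sum>i\<in>I. f i x)"
  by (simp add: smooth_on_def Ck_on_sum)

lemma smooth_on_prod:
  fixes f :: "'i \<Rightarrow> 'a::real_normed_vector \<Rightarrow> real"
  assumes "open S" "\<And>i. i \<in> I \<Longrightarrow> smooth_on S (f i)"
  shows "smooth_on S (\<lambda>x. \<Prod>i\<in>I. f i x)"
  using assms(2)
  by (induction I rule: infinite_finite_induct)
     (auto intro: smooth_on_const smooth_on_mult[OF assms(1)])

lemma smooth_on_compose:
  fixes f :: "'b::euclidean_space \<Rightarrow> 'c::real_normed_vector"
  shows "open S \<Longrightarrow> open T \<Longrightarrow> g ` S \<subseteq> T \<Longrightarrow> smooth_on T f \<Longrightarrow> smooth_on S g \<Longrightarrow>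
    smooth_on S (\<lambda>x. f (g x))"
  by (simp add: smooth_on_def Ck_on_compose)

lemma smooth_on_inverse:
  fixes f :: "'a::real_normed_vector \<Rightarrow> real"
  shows "open S \<Longrightarrow> (\<And>x. x \<in> S \<Longrightarrow> f x \<noteq> 0) \<Longrightarrow> smooth_on S f \<Longrightarrow> smooth_on S (\<lambda>x. inverse (f x))"
  by (simp add: smooth_on_def Ck_on_inverse)

section \<open>Linear systems with smooth coefficients\<close>

lemma smooth_on_det:
  fixes M :: "nat \<Rightarrow> nat \<Rightarrow> 'a::real_normed_vector \<Rightarrow> real"
  assumes "open S" "\<And>i j. i < n \<Longrightarrow> j < n \<Longrightarrow> smooth_on S (M i j)"
  shows "smooth_on S (\<lambda>x. det (mat n n (\<lambda>(i, j). M i j x)))"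
proof -
  have "smooth_on S (\<lambda>x. \<Sum>p\<in>{p. p permutes {0..<n}}. signof p * (\<Prod>i=0..<n. M i (p i) x))"
    by (intro smooth_on_sum smooth_on_mult smooth_on_prod smooth_on_const assms)
       (auto simp: permutes_in_image)
  moreover have "(\<Sum>p\<in>{p. p permutes {0..<n}}. signof p * (\<Prod>i=0..<n. M i (p i) x)) =
      det (mat n n (\<lambda>(i, j). M i j x))" for x
    by (auto simp: det_def permutes_in_image intro!: sum.cong prod.cong)
  ultimately show ?thesis
    by simp
qed

text \<open>The coefficients of the inverse matrix are cofactors divided by the determinant, hence smooth.\<close>
lemma smooth_on_matrix_inverse:
  fixes M :: "nat \<Rightarrow> nat \<Rightarrow> 'a::real_normed_vector \<Rightarrow> real"
  assumes S: "open S" and M: "\<And>i j. i < n \<Longrightarrow> j < n \<Longrightarrow> smooth_on S (M i j)"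
    and inj: "\<And>x v. x \<in> S \<Longrightarrow> (\<And>i. i < n \<Longrightarrow> (\<Sum>j<n. M i j x * v j) = 0) \<Longrightarrow>
      (\<And>j. j < n \<Longrightarrow> v j = (0::real))"
  shows "\<exists>N. (\<forall>i j. smooth_on S (N i j)) \<and>
    (\<forall>x\<in>S. \<forall>v w. (\<forall>i<n. w i = (\<Sum>j<n. M i j x * v j)) \<longrightarrow> (\<forall>j<n. v j = (\<Sum>i<n. N j i x * w i)))"
proof -
  define Mx where "Mx x = mat n n (\<lambda>(i, j). M i j x)" for x
  have Mx: "Mx x \<in> carrier_mat n n" for x
    by (simp add: Mx_def)
  have det: "det (Mx x) \<noteq> 0" if x: "x \<in> S" for x
  proof
    assume "det (Mx x) = 0"
    then obtain v where v: "v \<in> carrier_vec n" "v \<noteq> 0\<^sub>v n" "Mx x *\<^sub>v v = 0\<^sub>v n"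
      using det_0_iff_vec_prod_zero[OF Mx] by blast
    have "(\<Sum>j<n. M i j x * vec_index v j) = 0" if "i < n" for i
    proof -
      have "vec_index (Mx x *\<^sub>v v) i = 0"
        using v(3) that by simp
      then show ?thesis
        using that v(1) by (auto simp: Mx_def scalar_prod_def atLeast0LessThan)
    qed
    then have "vec_index v j = 0" if "j < n" for j
      using inj[OF x] that by blast
    then have "v = 0\<^sub>v n"
      using v(1) by (intro eq_vecI) auto
    with v(2) show False by simp
  qed
  define N where "N i j x = (if i < n \<and> j < n then inverse (det (Mx x)) * cofactor (Mx x) j i else 0)"
    for i j x
  have "smooth_on S (N i j)" for i j
  proof (cases "i < n \<and> j < n")
    case True
    let ?r = "\<lambda>i'. if i' < j then i' else Suc i'" and ?c = "\<lambda>j'. if j' < i then j' else Suc j'"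
    have "mat_delete (Mx x) j i = mat (n - 1) (n - 1) (\<lambda>(i', j'). M (?r i') (?c j') x)" for x
      using True by (auto simp: mat_delete_def Mx_def intro!: eq_matI)
    then have "smooth_on S (\<lambda>x. det (mat_delete (Mx x) j i))"
      by (simp only:) (intro smooth_on_det S M; use True in auto)
    then have "smooth_on S (\<lambda>x. inverse (det (Mx x)) * ((- 1) ^ (j + i) * det (mat_delete (Mx x) j i)))"
      using det
      by (intro smooth_on_mult smooth_on_inverse S smooth_on_const)
         (auto simp: Mx_def intro: smooth_on_det S M)
    then show ?thesis
      using True by (simp add: N_def[abs_def] cofactor_def)
  next
    case False
    then have "N i j = (\<lambda>x. 0)"
      by (auto simp: N_def)
    then show ?thesis
      by (simp add: smooth_on_const)
  qed
  moreover have "v j = (\<Sum>i<n. N j i x * w i)"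
    if x: "x \<in> S" and w: "\<forall>i<n. w i = (\<Sum>j<n. M i j x * v j)" and j: "j < n" for x v w j
  proof -
    have Nm: "(\<Sum>i<n. N j i x * M i k x) = (if j = k then 1 else 0)" if "k < n" for k
    proof -
      have "(adj_mat (Mx x) * Mx x) $$ (j, k) = (\<Sum>i<n. cofactor (Mx x) i j * M i k x)"
        using j that by (auto simp: adj_mat_def times_mat_def scalar_prod_def Mx_def atLeast0LessThan)
      moreover have "(adj_mat (Mx x) * Mx x) $$ (j, k) = det (Mx x) * (if j = k then 1 else 0)"
        using j that by (simp add: adj_mat(3)[OF Mx])
      moreover have "(\<Sum>i<n. N j i x * M i k x) = inverse (det (Mx x)) * (\<Sum>i<n. cofactor (Mx x) i j * M i k x)"
        using j by (simp add: N_def sum_distrib_left mult.assoc)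
      ultimately have "(\<Sum>i<n. N j i x * M i k x) = inverse (det (Mx x)) * (det (Mx x) * (if j = k then 1 else 0))"
        by presburger
      then show ?thesis
        using det[OF x] by simp
    qed
    have "(\<Sum>i<n. N j i x * w i) = (\<Sum>i<n. \<Sum>k<n. N j i x * M i k x * v k)"
      using w by (simp add: sum_distrib_left mult.assoc)
    also have "\<dots> = (\<Sum>k<n. (\<Sum>i<n. N j i x * M i k x) * v k)"
      by (subst sum.swap) (simp add: sum_distrib_right)
    also have "\<dots> = (\<Sum>k<n. if j = k then v k else 0)"
      using Nm by (intro sum.cong) auto
    finally show ?thesis
      using j by simp
  qed
  ultimately show ?thesis
    by (intro exI[of _ N]) blast
qed

section \<open>Tangent vectors\<close>

text \<open>Locality and linearity of tangent vectors depend on no more of the atlas than injectivity of its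
  charts.  The lemmas on them are stated in this generality to apply to the manifold and to its
  tangent bundle alike.\<close>

definition inj_charts :: "('p, 'e) atlas \<Rightarrow> bool" where
  "inj_charts B \<longleftrightarrow> (\<forall>(U, \<phi>)\<in>B. inj_on \<phi> U)"

lemma smooth_atlas_inj: "smooth_atlas A \<Longrightarrow> inj_charts A"
  by (auto simp: smooth_atlas_def inj_charts_def)

lemma inj_chartsD: "inj_charts B \<Longrightarrow> (U, \<phi>) \<in> B \<Longrightarrow> inj_on \<phi> U"
  by (auto simp: inj_charts_def)

lemma atlas_open_image: "atlas_open B W \<Longrightarrow> (U, \<phi>) \<in> B \<Longrightarrow> open (\<phi> ` (U \<inter> W))"
  by (auto simp: atlas_open_def)

lemma atlas_open_Int:
  assumes "inj_charts B" "atlas_open B V" "atlas_open B W"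
  shows "atlas_open B (V \<inter> W)"
proof -
  have "\<phi> ` (U \<inter> (V \<inter> W)) = \<phi> ` (U \<inter> V) \<inter> \<phi> ` (U \<inter> W)" if "(U, \<phi>) \<in> B" for U \<phi>
    using inj_chartsD[OF assms(1) that] by (auto simp: inj_on_def)
  with assms(2,3) show ?thesis
    by (fastforce simp: atlas_open_def)
qed

lemma smooth_fun_subset: "smooth_fun B W f \<Longrightarrow> V \<subseteq> W \<Longrightarrow> smooth_fun B V f"
  unfolding smooth_fun_def by (force intro: smooth_on_subset)

lemma smooth_fun_cong:
  assumes "inj_charts B" "atlas_open B W" "\<And>x. x \<in> W \<Longrightarrow> f x = h x" "smooth_fun B W f"
  shows "smooth_fun B W h"
  unfolding smooth_fun_def
proof safe
  fix U \<phi> assume c: "(U, \<phi>) \<in> B"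
  show "smooth_on (\<phi> ` (U \<inter> W)) (h \<circ> inv_into U \<phi>)"
  proof (rule smooth_on_cong[of _ "f \<circ> inv_into U \<phi>"])
    show "(f \<circ> inv_into U \<phi>) y = (h \<circ> inv_into U \<phi>) y" if "y \<in> \<phi> ` (U \<inter> W)" for y
      using that assms(3) inj_chartsD[OF assms(1) c] by auto
  qed (use assms(2,4) c in \<open>auto simp: atlas_open_def smooth_fun_def\<close>)
qed

lemma smooth_fun_const: "smooth_fun B W (\<lambda>x. r)"
  by (simp add: smooth_fun_def comp_def smooth_on_const)

lemma smooth_fun_add:
  assumes "atlas_open B W" "smooth_fun B W f" "smooth_fun B W h"
  shows "smooth_fun B W (\<lambda>x. f x + h x)"
  using assms by (auto simp: smooth_fun_def comp_def intro!: smooth_on_add atlas_open_image)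

lemma smooth_fun_mult:
  assumes "atlas_open B W" "smooth_fun B W f" "smooth_fun B W h"
  shows "smooth_fun B W (\<lambda>x. f x * h x)"
  using assms by (auto simp: smooth_fun_def comp_def intro!: smooth_on_mult atlas_open_image)

lemma smooth_fun_sum:
  assumes "atlas_open B W" "\<And>i. i \<in> I \<Longrightarrow> smooth_fun B W (f i)"
  shows "smooth_fun B W (\<lambda>x. \<Sum>i\<in>I. f i x)"
  using assms(2)
  by (induction I rule: infinite_finite_induct)
     (auto intro: smooth_fun_const smooth_fun_add[OF assms(1)])

lemma smooth_nearI: "atlas_open B W \<Longrightarrow> p \<in> W \<Longrightarrow> smooth_fun B W f \<Longrightarrow> smooth_near B p f"
  by (auto simp: smooth_near_def)

lemma smooth_near_cong:
  assumes B: "inj_charts B" and W: "atlas_open B W" "p \<in> W"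
    and eq: "\<And>x. x \<in> W \<Longrightarrow> f x = h x" and f: "smooth_near B p f"
  shows "smooth_near B p h"
proof -
  obtain V where V: "atlas_open B V" "p \<in> V" "smooth_fun B V f"
    using f by (auto simp: smooth_near_def)
  have VW: "atlas_open B (V \<inter> W)"
    using atlas_open_Int[OF B V(1) W(1)] .
  have "smooth_fun B (V \<inter> W) f"
    by (rule smooth_fun_subset[OF V(3)]) simp
  then have "smooth_fun B (V \<inter> W) h"
    using smooth_fun_cong[OF B VW] eq by auto
  then show ?thesis
    by (rule smooth_nearI[OF VW, rotated]) (use V(2) W(2) in auto)
qed

lemma smooth_near_cong_iff:
  assumes "inj_charts B" "atlas_open B W" "p \<in> W" "\<And>x. x \<in> W \<Longrightarrow> f x = h x"
  shows "smooth_near B p f \<longleftrightarrow> smooth_near B p h"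
  using smooth_near_cong[OF assms(1-3), of f h] smooth_near_cong[OF assms(1-3), of h f] assms(4)
  by auto

lemma smooth_near_lin:
  assumes B: "inj_charts B" and f: "smooth_near B p f" and h: "smooth_near B p h"
  shows "smooth_near B p (\<lambda>x. r * f x + s * h x)"
proof -
  obtain V W where VW: "atlas_open B V" "p \<in> V" "smooth_fun B V f"
      "atlas_open B W" "p \<in> W" "smooth_fun B W h"
    using f h by (auto simp: smooth_near_def)
  have o: "atlas_open B (V \<inter> W)"
    using atlas_open_Int[OF B VW(1,4)] .
  have "smooth_fun B (V \<inter> W) f" "smooth_fun B (V \<inter> W) h"
    using smooth_fun_subset[OF VW(3)] smooth_fun_subset[OF VW(6)] by simp_all
  then have "smooth_fun B (V \<inter> W) (\<lambda>x. r * f x + s * h x)"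
    by (intro smooth_fun_add smooth_fun_mult smooth_fun_const o)
  then show ?thesis
    by (rule smooth_nearI[OF o, rotated]) (use VW(2,5) in auto)
qed

lemma chart_vec_has_derivative:
  assumes "smooth_near B p f" "(U, \<phi>) \<in> B" "p \<in> U"
  shows "((f \<circ> inv_into U \<phi>) has_derivative (\<lambda>w. chart_vec B (U, \<phi>) p w f)) (at (\<phi> p))"
proof -
  obtain W where W: "atlas_open B W" "p \<in> W" "smooth_fun B W f"
    using assms(1) by (auto simp: smooth_near_def)
  have "(f \<circ> inv_into U \<phi>) differentiable (at (\<phi> p))"
    by (rule smooth_on_differentiable[of "\<phi> ` (U \<inter> W)"])
       (use W assms(2,3) in \<open>auto simp: smooth_fun_def\<close>)
  then show ?thesis
    using assms(1) by (simp add: chart_vec_def frechet_derivative_works)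
qed

lemma chart_vec_eqI:
  assumes "smooth_near B p f" "(U, \<phi>) \<in> B" "p \<in> U"
    and "((f \<circ> inv_into U \<phi>) has_derivative f') (at (\<phi> p))"
  shows "chart_vec B (U, \<phi>) p w f = f' w"
  using has_derivative_unique[OF chart_vec_has_derivative[OF assms(1-3)] assms(4)] by metis

lemma chart_vec_cong:
  assumes B: "inj_charts B" and W: "atlas_open B W" "p \<in> W"
    and eq: "\<And>x. x \<in> W \<Longrightarrow> f x = h x" and c: "(U, \<phi>) \<in> B" "p \<in> U"
  shows "chart_vec B (U, \<phi>) p w f = chart_vec B (U, \<phi>) p w h"
proof (cases "smooth_near B p f")
  case True
  then have h: "smooth_near B p h"
    using smooth_near_cong[of B W p f h] B W eq by blast
  have "((f \<circ> inv_into U \<phi>) has_derivative (\<lambda>w. chart_vec B (U, \<phi>) p w f)) (at (\<phi> p))"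
    using chart_vec_has_derivative[OF True c] .
  then have "((h \<circ> inv_into U \<phi>) has_derivative (\<lambda>w. chart_vec B (U, \<phi>) p w f)) (at (\<phi> p))"
  proof (rule has_derivative_transform_within_open)
    show "open (\<phi> ` (U \<inter> W))"
      using atlas_open_image[OF W(1) c(1)] .
    show "(f \<circ> inv_into U \<phi>) y = (h \<circ> inv_into U \<phi>) y" if "y \<in> \<phi> ` (U \<inter> W)" for y
      using that eq inj_chartsD[OF B c(1)] by auto
  qed (use c W in auto)
  then show ?thesis
    using chart_vec_eqI[OF h c] by metis
next
  case False
  then show ?thesis
    using smooth_near_cong_iff[of B W p f h] B W eq by (auto simp: chart_vec_def)
qed

lemma chart_vec_lin_fun:
  assumes B: "inj_charts B" and f: "smooth_near B p f" and h: "smooth_near B p h"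
    and c: "(U, \<phi>) \<in> B" "p \<in> U"
  shows "chart_vec B (U, \<phi>) p w (\<lambda>x. r * f x + s * h x) =
    r * chart_vec B (U, \<phi>) p w f + s * chart_vec B (U, \<phi>) p w h"
proof (rule chart_vec_eqI[OF smooth_near_lin[OF B f h] c])
  have 1: "(\<lambda>x. r * f x + s * h x) \<circ> inv_into U \<phi> =
      (\<lambda>x. r * (f \<circ> inv_into U \<phi>) x + s * (h \<circ> inv_into U \<phi>) x)"
    by auto
  show "((\<lambda>x. r * f x + s * h x) \<circ> inv_into U \<phi> has_derivative
      (\<lambda>w. r * chart_vec B (U, \<phi>) p w f + s * chart_vec B (U, \<phi>) p w h)) (at (\<phi> p))"
    unfolding 1
    by (intro has_derivative_add has_derivative_mult_right chart_vec_has_derivative f h c)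
qed

lemma chart_vec_lin:
  assumes "(U, \<phi>) \<in> B" "p \<in> U"
  shows "chart_vec B (U, \<phi>) p (r *\<^sub>R w + s *\<^sub>R w') =
    (\<lambda>f. r * chart_vec B (U, \<phi>) p w f + s * chart_vec B (U, \<phi>) p w' f)"
proof
  fix f
  show "chart_vec B (U, \<phi>) p (r *\<^sub>R w + s *\<^sub>R w') f =
    r * chart_vec B (U, \<phi>) p w f + s * chart_vec B (U, \<phi>) p w' f"
  proof (cases "smooth_near B p f")
    case True
    have "linear (\<lambda>w. chart_vec B (U, \<phi>) p w f)"
      using chart_vec_has_derivative[OF True assms] has_derivative_linear by blast
    from linear_add[OF this] linear_scale[OF this] show ?thesis
      by simp
  qed (simp add: chart_vec_def)
qed

lemma tangent_spaceE:
  assumes "u \<in> tangent_space B p"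
  obtains U \<phi> w where "(U, \<phi>) \<in> B" "p \<in> U" "u = chart_vec B (U, \<phi>) p w"
  using assms by (auto simp: tangent_space_def)

lemma tangent_pts: "u \<in> tangent_space B p \<Longrightarrow> p \<in> pts B"
  by (force elim!: tangent_spaceE simp: pts_def)

lemma tangent_cong:
  assumes "inj_charts B" "u \<in> tangent_space B p" "atlas_open B W" "p \<in> W" "\<And>x. x \<in> W \<Longrightarrow> f x = h x"
  shows "u f = u h"
  using assms(2) by (rule tangent_spaceE) (use chart_vec_cong[of B W p f h] assms in auto)

lemma tangent_lin_fun:
  assumes "inj_charts B" "u \<in> tangent_space B p" "smooth_near B p f" "smooth_near B p h"
  shows "u (\<lambda>x. r * f x + s * h x) = r * u f + s * u h"
  using assms(2) by (rule tangent_spaceE) (use chart_vec_lin_fun[OF assms(1,3-4)] in auto)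

lemma tangent_const_fun:
  assumes "u \<in> tangent_space B p" "atlas_open B W" "p \<in> W"
  shows "u (\<lambda>x. r) = 0"
  using assms(1)
proof (rule tangent_spaceE)
  fix U \<phi> w assume c: "(U, \<phi>) \<in> B" "p \<in> U" and u: "u = chart_vec B (U, \<phi>) p w"
  have "smooth_near B p (\<lambda>x. r)"
    using assms(2,3) by (auto intro: smooth_nearI smooth_fun_const)
  then show "u (\<lambda>x. r) = 0"
    unfolding u by (rule chart_vec_eqI[OF _ c]) (simp add: comp_def)
qed

lemma tangent_sum_fun:
  assumes B: "inj_charts B" "u \<in> tangent_space B p" and W: "atlas_open B W" "p \<in> W"
    and f: "\<And>i. i \<in> I \<Longrightarrow> smooth_fun B W (f i)"
  shows "u (\<lambda>x. \<Sum>i\<in>I. r i * f i x) = (\<Sum>i\<in>I. r i * u (f i))"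
  using f
proof (induction I rule: infinite_finite_induct)
  case (insert i I)
  have "smooth_near B p (\<lambda>x. \<Sum>i\<in>I. r i * f i x)"
    by (rule smooth_nearI[OF W], intro smooth_fun_sum smooth_fun_mult smooth_fun_const W)
       (use insert in auto)
  moreover have "smooth_near B p (f i)"
    using insert W by (auto intro: smooth_nearI)
  ultimately have "u (\<lambda>x. r i * f i x + 1 * (\<Sum>i\<in>I. r i * f i x)) =
      r i * u (f i) + 1 * u (\<lambda>x. \<Sum>i\<in>I. r i * f i x)"
    by (intro tangent_lin_fun[OF B])
  then show ?case
    using insert by simp
qed (use tangent_const_fun[OF B(2) W] in auto)

lemma atlas_open_pts:
  assumes "smooth_atlas A"
  shows "atlas_open A (pts A)"
proof -
  have "open (\<phi> ` (U \<inter> pts A))" if "(U, \<phi>) \<in> A" for U \<phi>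
  proof -
    have "U \<inter> pts A = U \<inter> U"
      using that by (force simp: pts_def)
    then show ?thesis
      using assms that unfolding smooth_atlas_def by fastforce
  qed
  then show ?thesis
    by (auto simp: atlas_open_def)
qed

lemma atlas_open_chart:
  assumes "smooth_atlas A" "(U, \<phi>) \<in> A"
  shows "atlas_open A U"
proof -
  have "U \<subseteq> pts A"
    using assms(2) by (force simp: pts_def)
  moreover have "open (\<psi> ` (V \<inter> U))" if "(V, \<psi>) \<in> A" for V \<psi>
    using assms that unfolding smooth_atlas_def by fastforce
  ultimately show ?thesis
    by (auto simp: atlas_open_def)
qed

lemma chart_open_image: "smooth_atlas A \<Longrightarrow> (U, \<phi>) \<in> A \<Longrightarrow> open (\<phi> ` U)"
  using atlas_open_image[OF atlas_open_chart] by fastforce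

lemma transition_smooth:
  "smooth_atlas A \<Longrightarrow> (U, \<phi>) \<in> A \<Longrightarrow> (V, \<psi>) \<in> A \<Longrightarrow>
    smooth_on (\<phi> ` (U \<inter> V)) (\<psi> \<circ> inv_into U \<phi>)"
  unfolding smooth_atlas_def by fast

text \<open>A function given by a smooth formula in one chart is smooth in all others, because the
  transition maps are smooth.\<close>
lemma smooth_near_chart:
  assumes A: "smooth_atlas A" and c: "(U, \<phi>) \<in> A" "p \<in> U" and f: "smooth_on (\<phi> ` U) f"
  shows "smooth_near A p (\<lambda>x. f (\<phi> x))"
proof (rule smooth_nearI[of _ U])
  show "smooth_fun A U (\<lambda>x. f (\<phi> x))"
    unfolding smooth_fun_def comp_def
  proof safe
    fix V \<psi> assume d: "(V, \<psi>) \<in> A"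
    show "smooth_on (\<psi> ` (V \<inter> U)) (\<lambda>x. f (\<phi> (inv_into V \<psi> x)))"
    proof (rule smooth_on_compose[of _ "\<phi> ` U"])
      show "open (\<psi> ` (V \<inter> U))"
        using atlas_open_image[OF atlas_open_chart[OF A c(1)] d] .
      show "(\<lambda>x. \<phi> (inv_into V \<psi> x)) ` \<psi> ` (V \<inter> U) \<subseteq> \<phi> ` U"
        using inj_chartsD[OF smooth_atlas_inj[OF A] d] by auto
      show "smooth_on (\<psi> ` (V \<inter> U)) (\<lambda>x. \<phi> (inv_into V \<psi> x))"
        using transition_smooth[OF A d c(1)] by (simp add: comp_def)
    qed (use f chart_open_image[OF A c(1)] in auto)
  qed
qed (use atlas_open_chart[OF A c(1)] c in auto)

lemma smooth_near_coord:
  assumes A: "smooth_atlas A" and c: "(U, \<phi>) \<in> A" "p \<in> U"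
  shows "smooth_near A p (\<lambda>x. \<phi> x \<bullet> b)"
  using smooth_near_chart[OF A c, of "\<lambda>x. x \<bullet> b"] chart_open_image[OF A c(1)]
  by (simp add: smooth_on_bounded_linear bounded_linear_inner_left)

lemma chart_vec_chart:
  assumes A: "smooth_atlas A" and c: "(U, \<phi>) \<in> A" "p \<in> U"
    and f: "smooth_near A p (\<lambda>x. f (\<phi> x))" and f': "(f has_derivative f') (at (\<phi> p))"
  shows "chart_vec A (U, \<phi>) p w (\<lambda>x. f (\<phi> x)) = f' w"
proof (rule chart_vec_eqI[OF f c])
  show "((\<lambda>x. f (\<phi> x)) \<circ> inv_into U \<phi> has_derivative f') (at (\<phi> p))"
    using f' chart_open_image[OF A c(1)]
  proof (rule has_derivative_transform_within_open)
    show "f y = ((\<lambda>x. f (\<phi> x)) \<circ> inv_into U \<phi>) y" if "y \<in> \<phi> ` U" for y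
      using that by (auto simp: f_inv_into_f)
  qed (use c in auto)
qed

lemma vec_coords_chart_vec:
  assumes A: "smooth_atlas A" and c: "(U, \<phi>) \<in> A" "p \<in> U"
  shows "vec_coords \<phi> (chart_vec A (U, \<phi>) p w) = w"
proof -
  have "chart_vec A (U, \<phi>) p w (\<lambda>x. \<phi> x \<bullet> b) = w \<bullet> b" for b
    by (rule chart_vec_chart[OF A c smooth_near_coord[OF A c]])
       (rule bounded_linear_imp_has_derivative[OF bounded_linear_inner_left])
  then show ?thesis
    by (simp add: vec_coords_def euclidean_representation)
qed

text \<open>The chain rule for the transition map: the vectors that one chart represents at a point are
  represented in every other chart around it.  Hence the tangent space is a vector space.\<close>
lemma chart_vec_change:
  assumes A: "smooth_atlas A" and c: "(U, \<phi>) \<in> A" "p \<in> U" and d: "(V, \<psi>) \<in> A" "p \<in> V"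
  shows "\<exists>w'. chart_vec A (V, \<psi>) p w = chart_vec A (U, \<phi>) p w'"
proof -
  define \<tau> where "\<tau> = \<phi> \<circ> inv_into V \<psi>"
  define \<tau>' where "\<tau>' = frechet_derivative \<tau> (at (\<psi> p))"
  have dom: "\<psi> p \<in> \<psi> ` (V \<inter> U)"
    using c d by auto
  have \<tau>: "(\<tau> has_derivative \<tau>') (at (\<psi> p))"
    using smooth_on_differentiable[OF transition_smooth[OF A d(1) c(1)] dom]
    by (simp add: \<tau>_def \<tau>'_def frechet_derivative_works)
  have \<tau>p: "\<tau> (\<psi> p) = \<phi> p"
    using inj_chartsD[OF smooth_atlas_inj[OF A] d(1)] d by (simp add: \<tau>_def)
  have "chart_vec A (V, \<psi>) p w f = chart_vec A (U, \<phi>) p (\<tau>' w) f" for f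
  proof (cases "smooth_near A p f")
    case True
    have "((f \<circ> inv_into U \<phi>) has_derivative (\<lambda>w. chart_vec A (U, \<phi>) p w f)) (at (\<tau> (\<psi> p)))"
      using chart_vec_has_derivative[OF True c] by (simp add: \<tau>p)
    from has_derivative_compose[OF \<tau> this]
    have "((\<lambda>x. (f \<circ> inv_into U \<phi>) (\<tau> x)) has_derivative
        (\<lambda>w. chart_vec A (U, \<phi>) p (\<tau>' w) f)) (at (\<psi> p))" .
    then have "((f \<circ> inv_into V \<psi>) has_derivative (\<lambda>w. chart_vec A (U, \<phi>) p (\<tau>' w) f)) (at (\<psi> p))"
    proof (rule has_derivative_transform_within_open)
      show "open (\<psi> ` (V \<inter> U))"
        using atlas_open_image[OF atlas_open_chart[OF A c(1)] d(1)] .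
      show "(f \<circ> inv_into U \<phi>) (\<tau> y) = (f \<circ> inv_into V \<psi>) y" if "y \<in> \<psi> ` (V \<inter> U)" for y
        using that inj_chartsD[OF smooth_atlas_inj[OF A] d(1)]
          inj_chartsD[OF smooth_atlas_inj[OF A] c(1)] by (auto simp: \<tau>_def)
    qed (use dom in auto)
    then show ?thesis
      using chart_vec_eqI[OF True d] by metis
  qed (simp add: chart_vec_def)
  then show ?thesis
    by blast
qed

lemma tangent_vec_eq:
  assumes A: "smooth_atlas A" and c: "(U, \<phi>) \<in> A" "p \<in> U" and u: "u \<in> tangent_space A p"
  shows "u = chart_vec A (U, \<phi>) p (vec_coords \<phi> u)"
  using u
proof (rule tangent_spaceE)
  fix V \<psi> w assume d: "(V, \<psi>) \<in> A" "p \<in> V" and w: "u = chart_vec A (V, \<psi>) p w"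
  obtain w' where "u = chart_vec A (U, \<phi>) p w'"
    using chart_vec_change[OF A c d] w by blast
  then show ?thesis
    using vec_coords_chart_vec[OF A c] by simp
qed

lemma chart_vec_tangent: "(U, \<phi>) \<in> B \<Longrightarrow> p \<in> U \<Longrightarrow> chart_vec B (U, \<phi>) p w \<in> tangent_space B p"
  by (force simp: tangent_space_def)

lemma vec_coords_lin:
  "vec_coords \<phi> (\<lambda>f. r * u f + s * v f) = r *\<^sub>R vec_coords \<phi> u + s *\<^sub>R vec_coords \<phi> v"
  by (simp add: vec_coords_def scaleR_add_left sum.distrib scaleR_sum_right)

lemma vec_coords_lin_comb:
  "vec_coords \<phi> (lin_comb I e v) = (\<Sum>\<alpha>\<in>I. v \<alpha> *\<^sub>R vec_coords \<phi> (e \<alpha>))"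
  unfolding vec_coords_def lin_comb_def scaleR_sum_left scaleR_sum_right
  by (subst sum.swap) simp

lemma tangent_lin:
  assumes A: "smooth_atlas A" and u: "u \<in> tangent_space A p" and v: "v \<in> tangent_space A p"
  shows "(\<lambda>f. r * u f + s * v f) \<in> tangent_space A p"
proof -
  obtain U \<phi> where c: "(U, \<phi>) \<in> A" "p \<in> U"
    using u by (auto elim: tangent_spaceE)
  have "(\<lambda>f. r * u f + s * v f) =
      chart_vec A (U, \<phi>) p (r *\<^sub>R vec_coords \<phi> u + s *\<^sub>R vec_coords \<phi> v)"
    unfolding chart_vec_lin[OF c] using tangent_vec_eq[OF A c u] tangent_vec_eq[OF A c v] by simp
  then show ?thesis
    using chart_vec_tangent[OF c] by simp
qed

lemma tangent_zero: "smooth_atlas A \<Longrightarrow> p \<in> pts A \<Longrightarrow> (\<lambda>f. 0) \<in> tangent_space A p"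
proof -
  assume A: "smooth_atlas A" "p \<in> pts A"
  then obtain U \<phi> where c: "(U, \<phi>) \<in> A" "p \<in> U"
    by (auto simp: pts_def)
  have "chart_vec A (U, \<phi>) p 0 = (\<lambda>f. 0)"
    using chart_vec_lin[OF c, of 0 0 0 0] by simp
  with chart_vec_tangent[OF c, of 0] show ?thesis
    by simp
qed

lemma tangent_lin_comb:
  assumes A: "smooth_atlas A" "p \<in> pts A" and e: "\<And>\<alpha>. \<alpha> \<in> I \<Longrightarrow> e \<alpha> \<in> tangent_space A p"
  shows "lin_comb I e v \<in> tangent_space A p"
  using e
proof (induction I rule: infinite_finite_induct)
  case (insert \<alpha> I)
  then have "(\<lambda>f. v \<alpha> * e \<alpha> f + 1 * lin_comb I e v f) \<in> tangent_space A p"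
    by (intro tangent_lin[OF A(1)]) auto
  with insert show ?case
    by (simp add: lin_comb_def)
qed (use tangent_zero[OF A] in \<open>auto simp: lin_comb_def\<close>)

lemma tangent_eqI:
  assumes A: "smooth_atlas A" and c: "(U, \<phi>) \<in> A" "p \<in> U"
    and "u \<in> tangent_space A p" "v \<in> tangent_space A p" "vec_coords \<phi> u = vec_coords \<phi> v"
  shows "u = v"
  using tangent_vec_eq[OF A c] assms(4-6) by metis

section \<open>Vector fields in a chart\<close>

lemma vector_field_tangent: "vector_field A Y \<Longrightarrow> p \<in> pts A \<Longrightarrow> Y p \<in> tangent_space A p"
  by (simp add: vector_field_def)

lemma vector_field_local_rep:
  "vector_field A Y \<Longrightarrow> (U, \<phi>) \<in> A \<Longrightarrow> smooth_on (\<phi> ` U) (local_rep (U, \<phi>) Y)"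
  by (auto simp: vector_field_def)

lemma local_rep_at:
  "smooth_atlas A \<Longrightarrow> (U, \<phi>) \<in> A \<Longrightarrow> p \<in> U \<Longrightarrow> local_rep (U, \<phi>) Y (\<phi> p) = vec_coords \<phi> (Y p)"
  using inj_chartsD[OF smooth_atlas_inj] by (fastforce simp: local_rep_def)

lemma local_rep_has_derivative:
  assumes "smooth_atlas A" "vector_field A Y" "(U, \<phi>) \<in> A" "p \<in> U"
  shows "(local_rep (U, \<phi>) Y has_derivative frechet_derivative (local_rep (U, \<phi>) Y) (at (\<phi> p))) (at (\<phi> p))"
  using smooth_on_differentiable[OF vector_field_local_rep[OF assms(2,3)]] assms(4)
  by (simp add: frechet_derivative_works)

text \<open>The coordinates of the bracket are its values on the coordinate functions, and \<open>Y(Z(x\<^sup>b))\<close> is the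
  derivative of the \<open>b\<close>-th coordinate of \<open>Z\<close> in the direction of \<open>Y\<close>.\<close>
lemma lie_bracket_coords:
  assumes A: "smooth_atlas A" and Y: "vector_field A Y" and Z: "vector_field A Z"
    and c: "(U, \<phi>) \<in> A" "p \<in> U"
  shows "vec_coords \<phi> (lie_bracket A Y Z p) =
    frechet_derivative (local_rep (U, \<phi>) Z) (at (\<phi> p)) (vec_coords \<phi> (Y p)) -
    frechet_derivative (local_rep (U, \<phi>) Y) (at (\<phi> p)) (vec_coords \<phi> (Z p))"
proof -
  have p: "p \<in> pts A"
    using c by (force simp: pts_def)
  have app: "V p (\<lambda>x. W x (\<lambda>x. \<phi> x \<bullet> b)) =
      frechet_derivative (local_rep (U, \<phi>) W) (at (\<phi> p)) (vec_coords \<phi> (V p)) \<bullet> b"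
    if V: "vector_field A V" and W: "vector_field A W" and b: "b \<in> Basis" for V W b
  proof -
    let ?f = "\<lambda>y. local_rep (U, \<phi>) W y \<bullet> b"
    have eq: "W x (\<lambda>x. \<phi> x \<bullet> b) = ?f (\<phi> x)" if "x \<in> U" for x
      using local_rep_at[OF A c(1) that, of W] b by (simp add: vec_coords_def)
    have "V p (\<lambda>x. W x (\<lambda>x. \<phi> x \<bullet> b)) = V p (\<lambda>x. ?f (\<phi> x))"
      by (rule tangent_cong[OF smooth_atlas_inj[OF A] vector_field_tangent[OF V p]
            atlas_open_chart[OF A c(1)] c(2)]) (rule eq)
    also have "\<dots> = chart_vec A (U, \<phi>) p (vec_coords \<phi> (V p)) (\<lambda>x. ?f (\<phi> x))"
      using tangent_vec_eq[OF A c vector_field_tangent[OF V p]] by simp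
    also have "\<dots> = frechet_derivative (local_rep (U, \<phi>) W) (at (\<phi> p)) (vec_coords \<phi> (V p)) \<bullet> b"
    proof (rule chart_vec_chart[OF A c])
      show "smooth_near A p (\<lambda>x. ?f (\<phi> x))"
        by (intro smooth_near_chart[OF A c] smooth_on_inner chart_open_image[OF A c(1)]
            vector_field_local_rep[OF W c(1)])
      show "(?f has_derivative
          (\<lambda>w. frechet_derivative (local_rep (U, \<phi>) W) (at (\<phi> p)) w \<bullet> b)) (at (\<phi> p))"
        by (intro has_derivative_inner_left local_rep_has_derivative[OF A W c])
    qed
    finally show ?thesis .
  qed
  have "lie_bracket A Y Z p (\<lambda>x. \<phi> x \<bullet> b) =
    (frechet_derivative (local_rep (U, \<phi>) Z) (at (\<phi> p)) (vec_coords \<phi> (Y p)) -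
    frechet_derivative (local_rep (U, \<phi>) Y) (at (\<phi> p)) (vec_coords \<phi> (Z p))) \<bullet> b" if "b \<in> Basis" for b
    using app[OF Y Z that] app[OF Z Y that] smooth_near_coord[OF A c]
    by (simp add: lie_bracket_def inner_diff_left)
  then have "vec_coords \<phi> (lie_bracket A Y Z p) = (\<Sum>b\<in>Basis.
    ((frechet_derivative (local_rep (U, \<phi>) Z) (at (\<phi> p)) (vec_coords \<phi> (Y p)) -
    frechet_derivative (local_rep (U, \<phi>) Y) (at (\<phi> p)) (vec_coords \<phi> (Z p))) \<bullet> b) *\<^sub>R b)"
    unfolding vec_coords_def[of \<phi> "lie_bracket A Y Z p"] by (intro sum.cong refl) simp
  then show ?thesis
    by (simp only: euclidean_representation)
qed

lemma local_rep_lin_comb: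
  "local_rep c (\<lambda>q. lin_comb I (\<lambda>\<alpha>. X \<alpha> q) v) = (\<lambda>x. \<Sum>\<alpha>\<in>I. v \<alpha> *\<^sub>R local_rep c (X \<alpha>) x)"
  by (simp add: local_rep_def vec_coords_lin_comb)

lemma vector_field_lin_comb:
  assumes A: "smooth_atlas A" and X: "\<And>\<alpha>. \<alpha> \<in> I \<Longrightarrow> vector_field A (X \<alpha>)"
  shows "vector_field A (\<lambda>q. lin_comb I (\<lambda>\<alpha>. X \<alpha> q) v)"
proof -
  have "smooth_on (\<phi> ` U) (\<lambda>x. \<Sum>\<alpha>\<in>I. v \<alpha> *\<^sub>R local_rep (U, \<phi>) (X \<alpha>) x)" if "(U, \<phi>) \<in> A" for U \<phi>
    unfolding smooth_on_def
    using vector_field_local_rep[OF X that] chart_open_image[OF A that]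
    by (intro allI Ck_on_sum Ck_on_bilinear[OF _ bounded_bilinear_scaleR] Ck_on_const)
       (auto simp: smooth_on_def)
  moreover have "lin_comb I (\<lambda>\<alpha>. X \<alpha> p) v \<in> tangent_space A p" if "p \<in> pts A" for p
    by (rule tangent_lin_comb[OF A that]) (rule vector_field_tangent[OF X that])
  ultimately show ?thesis
    by (auto simp: vector_field_def local_rep_lin_comb)
qed

text \<open>With constant coefficients the bracket is linear.  That brackets are tangent vectors is taken as
  a hypothesis because it is immediate in the presence of a torsion-free connection.\<close>
lemma lie_bracket_lin_comb:
  assumes A: "smooth_atlas A" and p: "p \<in> pts A"
    and X: "\<And>\<alpha>. \<alpha> \<in> I \<Longrightarrow> vector_field A (X \<alpha>)" and Y: "vector_field A Y"
    and br: "\<And>V W. vector_field A V \<Longrightarrow> vector_field A W \<Longrightarrow> lie_bracket A V W p \<in> tangent_space A p"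
  shows "lie_bracket A (\<lambda>q. lin_comb I (\<lambda>\<alpha>. X \<alpha> q) v) Y p = lin_comb I (\<lambda>\<alpha>. lie_bracket A (X \<alpha>) Y p) v"
proof -
  let ?V = "\<lambda>q. lin_comb I (\<lambda>\<alpha>. X \<alpha> q) v"
  obtain U \<phi> where c: "(U, \<phi>) \<in> A" "p \<in> U"
    using p by (auto simp: pts_def)
  let ?D = "\<lambda>Y. frechet_derivative (local_rep (U, \<phi>) Y) (at (\<phi> p))"
  have V: "vector_field A ?V"
    using vector_field_lin_comb[OF A X] .
  have lin: "linear (?D Y)"
    using local_rep_has_derivative[OF A Y c] has_derivative_linear by blast
  have "(local_rep (U, \<phi>) ?V has_derivative (\<lambda>h. \<Sum>\<alpha>\<in>I. v \<alpha> *\<^sub>R ?D (X \<alpha>) h)) (at (\<phi> p))"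
    unfolding local_rep_lin_comb
    by (intro has_derivative_sum has_derivative_scaleR_right local_rep_has_derivative[OF A X c])
  then have DV: "?D ?V = (\<lambda>h. \<Sum>\<alpha>\<in>I. v \<alpha> *\<^sub>R ?D (X \<alpha>) h)"
    by (rule frechet_derivative_at[symmetric])
  have "vec_coords \<phi> (lie_bracket A ?V Y p) =
      (\<Sum>\<alpha>\<in>I. v \<alpha> *\<^sub>R vec_coords \<phi> (lie_bracket A (X \<alpha>) Y p))"
    unfolding lie_bracket_coords[OF A V Y c] DV vec_coords_lin_comb linear_sum[OF lin]
    using lie_bracket_coords[OF A X Y c]
    by (simp add: linear_scale[OF lin] sum_subtractf scaleR_diff_right)
  then have "vec_coords \<phi> (lie_bracket A ?V Y p) = vec_coords \<phi> (lin_comb I (\<lambda>\<alpha>. lie_bracket A (X \<alpha>) Y p) v)"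
    by (simp add: vec_coords_lin_comb)
  moreover have "lin_comb I (\<lambda>\<alpha>. lie_bracket A (X \<alpha>) Y p) v \<in> tangent_space A p"
    by (intro tangent_lin_comb[OF A p] br X Y)
  ultimately show ?thesis
    using tangent_eqI[OF A c br[OF V Y]] by blast
qed

section \<open>Frames and tensors\<close>

lemma frame_vector_field: "global_frame A n X \<Longrightarrow> \<alpha> \<in> {1..n} \<Longrightarrow> vector_field A (X \<alpha>)"
  by (simp add: global_frame_def)

lemma frame_comp_unique:
  assumes fr: "global_frame A n X" and u: "u \<in> tangent_space A p"
    and v: "\<And>\<beta>. \<beta> \<notin> {1..n} \<Longrightarrow> v \<beta> = 0" and eq: "u = lin_comb {1..n} (\<lambda>\<beta>. X \<beta> p) v"
  shows "frame_comp n X \<alpha> (p, u) = v \<alpha>"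
proof -
  have "\<exists>!v. (\<forall>\<beta>. \<beta> \<notin> {1..n} \<longrightarrow> v \<beta> = 0) \<and> u = lin_comb {1..n} (\<lambda>\<beta>. X \<beta> p) v"
    using fr u tangent_pts[OF u] by (simp add: global_frame_def)
  from the1_equality[OF this, of v] v eq show ?thesis
    by (simp add: frame_comp_def)
qed

lemma lin_comb_cong: "(\<And>\<alpha>. \<alpha> \<in> I \<Longrightarrow> v \<alpha> = w \<alpha>) \<Longrightarrow> lin_comb I e v = lin_comb I e w"
  by (simp add: lin_comb_def)

lemma lin_comb_extend:
  assumes "finite J" "I \<subseteq> J"
  shows "lin_comb I e v = lin_comb J e (\<lambda>\<alpha>. if \<alpha> \<in> I then v \<alpha> else 0)"
  unfolding lin_comb_def
  by (rule ext, rule sum.mono_neutral_cong_left[OF assms]) auto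

lemma frame_expand:
  assumes fr: "global_frame A n X" and u: "u \<in> tangent_space A p"
  shows "u = lin_comb {1..n} (\<lambda>\<beta>. X \<beta> p) (\<lambda>\<alpha>. frame_comp n X \<alpha> (p, u))"
proof -
  obtain v where v: "\<forall>\<beta>. \<beta> \<notin> {1..n} \<longrightarrow> v \<beta> = 0" "u = lin_comb {1..n} (\<lambda>\<beta>. X \<beta> p) v"
    using fr u tangent_pts[OF u] unfolding global_frame_def by blast
  then have "frame_comp n X \<alpha> (p, u) = v \<alpha>" for \<alpha>
    using frame_comp_unique[OF fr u] by blast
  with v(2) show ?thesis by presburger
qed

lemma frame_tangent:
  "smooth_atlas A \<Longrightarrow> global_frame A n X \<Longrightarrow> p \<in> pts A \<Longrightarrow> I \<subseteq> {1..n} \<Longrightarrow>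
    lin_comb I (\<lambda>\<beta>. X \<beta> p) v \<in> tangent_space A p"
  by (intro tangent_lin_comb vector_field_tangent frame_vector_field) auto

lemma frame_comp_lin_comb:
  assumes A: "smooth_atlas A" and fr: "global_frame A n X" and p: "p \<in> pts A" and I: "I \<subseteq> {1..n}"
  shows "frame_comp n X \<alpha> (p, lin_comb I (\<lambda>\<beta>. X \<beta> p) v) = (if \<alpha> \<in> I then v \<alpha> else 0)"
  by (rule frame_comp_unique[OF fr frame_tangent[OF A fr p I]])
     (use I lin_comb_extend[of "{1..n}" I] in auto)

lemma frame_independent:
  assumes A: "smooth_atlas A" and fr: "global_frame A n X" and p: "p \<in> pts A" and I: "I \<subseteq> {1..n}"
    and z: "lin_comb I (\<lambda>\<beta>. X \<beta> p) v = (\<lambda>f. 0)" and \<alpha>: "\<alpha> \<in> I"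
  shows "v \<alpha> = 0"
proof -
  have "lin_comb I (\<lambda>\<beta>. X \<beta> p) v = lin_comb I (\<lambda>\<beta>. X \<beta> p) (\<lambda>\<beta>. 0)"
    by (simp add: z) (simp add: lin_comb_def)
  then show ?thesis
    using frame_comp_lin_comb[OF A fr p I, of \<alpha> v] frame_comp_lin_comb[OF A fr p I, of \<alpha> "\<lambda>\<beta>. 0"] \<alpha>
    by simp
qed

lemma tensor_sym:
  "sym_tensor_field A s \<Longrightarrow> u \<in> tangent_space A p \<Longrightarrow> v \<in> tangent_space A p \<Longrightarrow> s p u v = s p v u"
  using tangent_pts[of u A p] unfolding sym_tensor_field_def by simp

lemma tensor_lin_left:
  assumes "sym_tensor_field A s" "u \<in> tangent_space A p" "v \<in> tangent_space A p" "w \<in> tangent_space A p"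
  shows "s p (\<lambda>f. a * u f + b * v f) w = a * s p u w + b * s p v w"
  using assms tangent_pts[OF assms(2)] unfolding sym_tensor_field_def by simp

lemma tensor_zero_left:
  assumes "sym_tensor_field A s" "w \<in> tangent_space A p"
  shows "s p (\<lambda>f. 0) w = 0"
  using tensor_lin_left[OF assms(1,2,2,2), of 0 0] by simp

lemma tensor_lin_comb_left:
  assumes A: "smooth_atlas A" and s: "sym_tensor_field A s" and w: "w \<in> tangent_space A p"
    and e: "\<And>\<alpha>. \<alpha> \<in> I \<Longrightarrow> e \<alpha> \<in> tangent_space A p"
  shows "s p (lin_comb I e v) w = (\<Sum>\<alpha>\<in>I. v \<alpha> * s p (e \<alpha>) w)"
  using e
proof (induction I rule: infinite_finite_induct)
  case (insert \<alpha> I)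
  have "lin_comb I e v \<in> tangent_space A p"
    using insert by (intro tangent_lin_comb[OF A tangent_pts[OF w]]) auto
  from tensor_lin_left[OF s _ this w, of "e \<alpha>" "v \<alpha>" 1]
  have "s p (lin_comb (insert \<alpha> I) e v) w = v \<alpha> * s p (e \<alpha>) w + s p (lin_comb I e v) w"
    using insert by (simp add: lin_comb_def)
  with insert show ?case
    by simp
qed (use tensor_zero_left[OF s w] in \<open>auto simp: lin_comb_def\<close>)

lemma tensor_lin_comb_right:
  assumes A: "smooth_atlas A" and s: "sym_tensor_field A s" and w: "w \<in> tangent_space A p"
    and e: "\<And>\<alpha>. \<alpha> \<in> I \<Longrightarrow> e \<alpha> \<in> tangent_space A p"
  shows "s p w (lin_comb I e v) = (\<Sum>\<alpha>\<in>I. v \<alpha> * s p w (e \<alpha>))"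
  using tensor_lin_comb_left[OF A s w e] tensor_sym[OF s w]
    tangent_lin_comb[OF A tangent_pts[OF w], of I e v] e by simp

lemma tensor_smooth:
  "sym_tensor_field A s \<Longrightarrow> vector_field A Y \<Longrightarrow> vector_field A W \<Longrightarrow>
    smooth_fun A (pts A) (\<lambda>q. s q (Y q) (W q))"
  by (simp add: sym_tensor_field_def)

section \<open>Smooth functions on the tangent bundle\<close>

definition bundle_dom :: "('p, 'e::euclidean_space) atlas \<Rightarrow> 'p set \<Rightarrow> ('p \<times> 'p tvec) set" where
  "bundle_dom A U = {(p, u). p \<in> U \<and> u \<in> tangent_space A p}"

definition bundle_map :: "('p \<Rightarrow> 'e::euclidean_space) \<Rightarrow> 'p \<times> 'p tvec \<Rightarrow> 'e \<times> 'e" where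
  "bundle_map \<phi> = (\<lambda>(p, u). (\<phi> p, vec_coords \<phi> u))"

lemma chart_dom_subset: "(U, \<phi>) \<in> A \<Longrightarrow> U \<subseteq> pts A"
  by (auto simp: pts_def)

lemma tangent_chart_eq: "tangent_chart A (U, \<phi>) = (bundle_dom A U, bundle_map \<phi>)"
  by (simp add: tangent_chart_def bundle_dom_def bundle_map_def)

lemma tangent_atlas_iff:
  "c \<in> tangent_atlas A \<longleftrightarrow> (\<exists>U \<phi>. (U, \<phi>) \<in> A \<and> c = (bundle_dom A U, bundle_map \<phi>))"
  by (force simp: tangent_atlas_def tangent_chart_eq[symmetric])

lemma bundle_map_inj:
  assumes A: "smooth_atlas A" and c: "(U, \<phi>) \<in> A"
  shows "inj_on (bundle_map \<phi>) (bundle_dom A U)"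
proof (rule inj_onI, clarsimp simp: bundle_dom_def bundle_map_def)
  fix p u q v
  assume *: "p \<in> U" "u \<in> tangent_space A p" "q \<in> U" "v \<in> tangent_space A q" "\<phi> p = \<phi> q"
    "vec_coords \<phi> u = vec_coords \<phi> v"
  then have "p = q"
    using inj_chartsD[OF smooth_atlas_inj[OF A] c] by (auto simp: inj_on_def)
  with * show "p = q \<and> u = v"
    using tangent_eqI[OF A c] by blast
qed

lemma bundle_inj_charts: "smooth_atlas A \<Longrightarrow> inj_charts (tangent_atlas A)"
  using bundle_map_inj by (auto simp: inj_charts_def tangent_atlas_iff)

lemma bundle_map_image:
  assumes A: "smooth_atlas A" and c: "(U, \<phi>) \<in> A"
  shows "bundle_map \<phi> ` bundle_dom A U = \<phi> ` U \<times> UNIV"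
proof -
  have "(\<phi> p, w) \<in> bundle_map \<phi> ` bundle_dom A U" if "p \<in> U" for p w
    using chart_vec_tangent[OF c that, of w] vec_coords_chart_vec[OF A c that, of w] that
    by (intro image_eqI[of _ _ "(p, chart_vec A (U, \<phi>) p w)"]) (auto simp: bundle_map_def bundle_dom_def)
  then show ?thesis
    by (auto simp: bundle_map_def bundle_dom_def)
qed

lemma pts_tangent_atlas: "pts (tangent_atlas A) = {(p, u). p \<in> pts A \<and> u \<in> tangent_space A p}"
proof -
  have "pts (tangent_atlas A) = (\<Union>c\<in>A. bundle_dom A (fst c))"
    by (auto simp: pts_def tangent_atlas_def tangent_chart_def bundle_dom_def)
  then show ?thesis
    by (auto simp: pts_def bundle_dom_def)
qed

lemma bundle_dom_Int_pts: "(U, \<phi>) \<in> A \<Longrightarrow> bundle_dom A U \<inter> pts (tangent_atlas A) = bundle_dom A U"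
  using chart_dom_subset[of U \<phi> A] by (auto simp: pts_tangent_atlas bundle_dom_def)

lemma atlas_open_tangent:
  assumes A: "smooth_atlas A"
  shows "atlas_open (tangent_atlas A) (pts (tangent_atlas A))"
  unfolding atlas_open_def
proof (safe)
  fix V \<psi> assume "(V, \<psi>) \<in> tangent_atlas A"
  then obtain U \<phi> where c: "(U, \<phi>) \<in> A" "V = bundle_dom A U" "\<psi> = bundle_map \<phi>"
    by (auto simp: tangent_atlas_iff)
  have "open (\<phi> ` U \<times> (UNIV :: 'b set))"
    by (intro open_Times chart_open_image[OF A c(1)] open_UNIV)
  then show "open (\<psi> ` (V \<inter> pts (tangent_atlas A)))"
    by (simp add: c(2,3) bundle_dom_Int_pts[OF c(1)] bundle_map_image[OF A c(1)])
qed

text \<open>Every point of an induced chart comes from exactly one tangent vector, so smoothness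
  reduces to exhibiting one formula in \<open>(x, w)\<close> for each chart of the base.\<close>
lemma smooth_fun_tangentI:
  fixes A :: "('p, 'e::euclidean_space) atlas"
  assumes A: "smooth_atlas A"
    and F: "\<And>U \<phi>. (U, \<phi>) \<in> A \<Longrightarrow> \<exists>G. smooth_on (\<phi> ` U \<times> UNIV) G \<and>
      (\<forall>p\<in>U. \<forall>u\<in>tangent_space A p. F (p, u) = G (\<phi> p, vec_coords \<phi> u))"
  shows "smooth_fun (tangent_atlas A) (pts (tangent_atlas A)) F"
  unfolding smooth_fun_def
proof safe
  fix V \<psi> assume "(V, \<psi>) \<in> tangent_atlas A"
  then obtain U \<phi> where c: "(U, \<phi>) \<in> A" "V = bundle_dom A U" "\<psi> = bundle_map \<phi>"
    by (auto simp: tangent_atlas_iff)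
  obtain G where G: "smooth_on (\<phi> ` U \<times> UNIV) G"
      "\<And>p u. p \<in> U \<Longrightarrow> u \<in> tangent_space A p \<Longrightarrow> F (p, u) = G (\<phi> p, vec_coords \<phi> u)"
    using F[OF c(1)] by blast
  have dom: "\<psi> ` (V \<inter> pts (tangent_atlas A)) = \<phi> ` U \<times> UNIV"
    by (simp add: c(2,3) bundle_dom_Int_pts[OF c(1)] bundle_map_image[OF A c(1)])
  show "smooth_on (\<psi> ` (V \<inter> pts (tangent_atlas A))) (F \<circ> inv_into V \<psi>)"
    unfolding dom
  proof (rule smooth_on_cong[OF _ _ G(1)])
    show "open (\<phi> ` U \<times> (UNIV :: 'e set))"
      by (intro open_Times chart_open_image[OF A c(1)] open_UNIV)
    fix y assume "y \<in> \<phi> ` U \<times> (UNIV :: 'e set)"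
    then have "y \<in> bundle_map \<phi> ` bundle_dom A U"
      by (simp add: bundle_map_image[OF A c(1)])
    then obtain p u where pu: "p \<in> U" "u \<in> tangent_space A p" "y = bundle_map \<phi> (p, u)"
      by (auto simp: bundle_dom_def)
    then have "inv_into V \<psi> y = (p, u)"
      unfolding c(2,3) using inv_into_f_f[OF bundle_map_inj[OF A c(1)], of "(p, u)"]
      by (simp add: bundle_dom_def)
    then show "G y = (F \<circ> inv_into V \<psi>) y"
      using pu G(2) by (simp add: bundle_map_def)
  qed
qed

lemma smooth_near_tangent:
  assumes "smooth_atlas A" "smooth_fun (tangent_atlas A) (pts (tangent_atlas A)) F"
    and "u \<in> tangent_space A p"
  shows "smooth_near (tangent_atlas A) (p, u) F"
  by (rule smooth_nearI[OF atlas_open_tangent[OF assms(1)] _ assms(2)])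
     (use assms(3) tangent_pts in \<open>auto simp: pts_tangent_atlas\<close>)

lemma smooth_on_fst:
  fixes f :: "'a::euclidean_space \<Rightarrow> 'c::real_normed_vector"
  assumes "open S" "smooth_on S f"
  shows "smooth_on (S \<times> (UNIV :: 'b::real_normed_vector set)) (\<lambda>y. f (fst y))"
  by (rule smooth_on_compose[of _ S fst f])
     (use assms in \<open>auto intro: open_Times smooth_on_bounded_linear bounded_linear_fst\<close>)

lemma smooth_funD:
  assumes "smooth_fun B W f" "(U, \<phi>) \<in> B"
  shows "smooth_on (\<phi> ` (U \<inter> W)) (f \<circ> inv_into U \<phi>)"
  using bspec[OF assms(1)[unfolded smooth_fun_def] assms(2)] by simp

lemma smooth_fun_base:
  fixes A :: "('p, 'e::euclidean_space) atlas"
  assumes A: "smooth_atlas A" and f: "smooth_fun A (pts A) f"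
  shows "smooth_fun (tangent_atlas A) (pts (tangent_atlas A)) (\<lambda>y. f (fst y))"
proof (rule smooth_fun_tangentI[OF A])
  fix U \<phi> assume c: "(U, \<phi>) \<in> A"
  let ?G = "\<lambda>y :: 'e \<times> 'e. (f \<circ> inv_into U \<phi>) (fst y)"
  have Ui: "U \<inter> pts A = U"
    using chart_dom_subset[OF c] by auto
  have "smooth_on (\<phi> ` U) (f \<circ> inv_into U \<phi>)"
    using smooth_funD[OF f c] by (simp only: Ui)
  then have "smooth_on (\<phi> ` U \<times> UNIV) ?G"
    by (rule smooth_on_fst[OF chart_open_image[OF A c]])
  moreover have "f p = ?G (\<phi> p, w)" if "p \<in> U" for p w
    using that inj_chartsD[OF smooth_atlas_inj[OF A] c] by simp
  ultimately show "\<exists>G. smooth_on (\<phi> ` U \<times> UNIV) G \<and>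
      (\<forall>p\<in>U. \<forall>u\<in>tangent_space A p. f (fst (p, u)) = G (\<phi> p, vec_coords \<phi> u))"
    by (intro exI[of _ ?G]) simp
qed

text \<open>If \<open>M\<close> is the matrix of the coordinates of the frame vectors in a chart, then the frame
  components of a vector with coordinates \<open>w\<close> are the entries of \<open>M\<^sup>-\<^sup>1 w\<close>, which depend smoothly
  on the point and on \<open>w\<close>.\<close>
lemma smooth_frame_comp:
  fixes A :: "('p, 'e::euclidean_space) atlas"
  assumes A: "smooth_atlas A" and dim: "n = DIM('e)" and fr: "global_frame A n X" and \<alpha>: "\<alpha> \<in> {1..n}"
  shows "smooth_fun (tangent_atlas A) (pts (tangent_atlas A)) (frame_comp n X \<alpha>)"
proof (rule smooth_fun_tangentI[OF A])
  fix U \<phi> assume c: "(U, \<phi>) \<in> A"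
  obtain b where b: "bij_betw b {..<n} (Basis :: 'e set)"
    using ex_bij_betw_nat_finite[of "Basis :: 'e set"] dim by (auto simp: atLeast0LessThan)
  have pts: "p \<in> pts A" if "p \<in> U" for p
    using chart_dom_subset[OF c] that by auto
  define M where "M i j x = local_rep (U, \<phi>) (X (Suc j)) x \<bullet> b i" for i j x
  \<comment> \<open>Frame indices start at \<open>1\<close>, matrix indices at \<open>0\<close>.\<close>
  have shift: "(\<Sum>j<n. h (Suc j)) = (\<Sum>\<alpha>=1..n. h \<alpha>)" for h :: "nat \<Rightarrow> real"
    by (simp add: sum.atLeast_Suc_atMost_Suc_shift lessThan_Suc_atMost sum.atLeast1_atMost_eq)
  have coord: "vec_coords \<phi> (lin_comb {1..n} (\<lambda>\<beta>. X \<beta> p) v) \<bullet> b i = (\<Sum>j<n. M i j (\<phi> p) * v (Suc j))"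
    if "p \<in> U" for p v i
    using shift[of "\<lambda>\<alpha>. v \<alpha> * (vec_coords \<phi> (X \<alpha> p) \<bullet> b i)"]
    by (simp add: vec_coords_lin_comb inner_sum_left M_def local_rep_at[OF A c that] mult.commute)
  have "\<exists>N. (\<forall>i j. smooth_on (\<phi> ` U) (N i j)) \<and>
    (\<forall>x\<in>\<phi> ` U. \<forall>v w. (\<forall>i<n. w i = (\<Sum>j<n. M i j x * v j)) \<longrightarrow> (\<forall>j<n. v j = (\<Sum>i<n. N j i x * w i)))"
  proof (rule smooth_on_matrix_inverse)
    show "open (\<phi> ` U)"
      by (rule chart_open_image[OF A c])
    show "smooth_on (\<phi> ` U) (M i j)" if "j < n" for i j
      unfolding M_def[abs_def] using that
      by (intro smooth_on_inner chart_open_image[OF A c] vector_field_local_rep[OF _ c]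
          frame_vector_field[OF fr]) auto
    fix x v j
    assume x: "x \<in> \<phi> ` U" and z: "\<And>i. i < n \<Longrightarrow> (\<Sum>j<n. M i j x * v j) = 0" and j: "j < n"
    obtain p where p: "p \<in> U" "x = \<phi> p"
      using x by blast
    let ?u = "lin_comb {1..n} (\<lambda>\<beta>. X \<beta> p) (\<lambda>\<alpha>. v (\<alpha> - 1))"
    have ui: "vec_coords \<phi> ?u \<bullet> b i = 0" if "i < n" for i
      using coord[OF p(1), of "\<lambda>\<alpha>. v (\<alpha> - 1)" i] z[OF that] p(2) by simp
    have "vec_coords \<phi> ?u = 0"
    proof (rule euclidean_eqI)
      fix e :: 'e assume "e \<in> Basis"
      then obtain i where "i < n" "e = b i"
        using b by (auto simp: bij_betw_def)
      then show "vec_coords \<phi> ?u \<bullet> e = 0 \<bullet> e"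
        using ui by simp
    qed
    also have "\<dots> = vec_coords \<phi> (\<lambda>f. 0 :: real)"
      by (simp add: vec_coords_def)
    finally have "?u = (\<lambda>f. 0)"
      by (intro tangent_eqI[OF A c p(1)] frame_tangent[OF A fr pts[OF p(1)]] tangent_zero[OF A pts[OF p(1)]])
         auto
    from frame_independent[OF A fr pts[OF p(1)] order_refl this, of "Suc j"] j
    show "v j = 0" by simp
  qed
  then obtain N where N': "\<forall>i j. smooth_on (\<phi> ` U) (N i j)"
    and inv': "\<forall>x\<in>\<phi> ` U. \<forall>v w. (\<forall>i<n. w i = (\<Sum>j<n. M i j x * v j)) \<longrightarrow>
      (\<forall>j<n. v j = (\<Sum>i<n. N j i x * w i))"
    by (elim exE conjE)
  have N: "smooth_on (\<phi> ` U) (N i j)" for i j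
    using N' by simp
  have inv: "v j = (\<Sum>i<n. N j i x * w i)"
    if "x \<in> \<phi> ` U" "\<And>i. i < n \<Longrightarrow> w i = (\<Sum>j<n. M i j x * v j)" "j < n" for x v w j
    by (rule inv'[rule_format, OF that(1) _ that(3)]) (rule that(2))
  let ?G = "\<lambda>y :: 'e \<times> 'e. \<Sum>i<n. N (\<alpha> - 1) i (fst y) * (snd y \<bullet> b i)"
  have "smooth_on (\<phi> ` U \<times> UNIV) ?G"
    by (intro smooth_on_sum smooth_on_mult smooth_on_inner smooth_on_fst N chart_open_image[OF A c]
        smooth_on_bounded_linear bounded_linear_snd open_Times open_UNIV)
  moreover have "frame_comp n X \<alpha> (p, u) = ?G (\<phi> p, vec_coords \<phi> u)"
    if p: "p \<in> U" and u: "u \<in> tangent_space A p" for p u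
  proof -
    have "vec_coords \<phi> u \<bullet> b i = (\<Sum>j<n. M i j (\<phi> p) * frame_comp n X (Suc j) (p, u))" for i
      by (subst frame_expand[OF fr u]) (rule coord[OF p])
    moreover have "\<alpha> - 1 < n"
      using \<alpha> by auto
    ultimately show ?thesis
      using inv[of "\<phi> p" "\<lambda>i. vec_coords \<phi> u \<bullet> b i" "\<lambda>j. frame_comp n X (Suc j) (p, u)" "\<alpha> - 1"] p \<alpha>
      by simp
  qed
  ultimately show "\<exists>G. smooth_on (\<phi> ` U \<times> UNIV) G \<and>
      (\<forall>p\<in>U. \<forall>u\<in>tangent_space A p. frame_comp n X \<alpha> (p, u) = G (\<phi> p, vec_coords \<phi> u))"
    by (intro exI[of _ ?G]) blast
qed

text \<open>These fibrewise linear functions are smooth extensions, to the whole tangent bundle, of the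
  functions on the distribution that are differentiated: the derivatives \<open>Y\<^sup>V(L)\<close> and the \<open>\<theta>\<^sub>i\<close>.\<close>
definition contract :: "'p tensor2 \<Rightarrow> 'p vfield \<Rightarrow> 'p \<times> 'p tvec \<Rightarrow> real" where
  "contract s Y = (\<lambda>(p, u). s p u (Y p))"

lemma smooth_contract:
  fixes A :: "('p, 'e::euclidean_space) atlas"
  assumes A: "smooth_atlas A" and dim: "n = DIM('e)" and fr: "global_frame A n X"
    and s: "sym_tensor_field A s" and Y: "vector_field A Y"
  shows "smooth_fun (tangent_atlas A) (pts (tangent_atlas A)) (contract s Y)"
proof (rule smooth_fun_cong[OF bundle_inj_charts[OF A] atlas_open_tangent[OF A]])
  let ?h = "\<lambda>y. \<Sum>\<alpha>=1..n. frame_comp n X \<alpha> y * s (fst y) (X \<alpha> (fst y)) (Y (fst y))"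
  show "smooth_fun (tangent_atlas A) (pts (tangent_atlas A)) ?h"
    by (intro smooth_fun_sum smooth_fun_mult atlas_open_tangent[OF A] smooth_frame_comp[OF A dim fr]
        smooth_fun_base[OF A, of "\<lambda>q. s q (X _ q) (Y q)"] tensor_smooth[OF s _ Y] frame_vector_field[OF fr])
  fix y assume "y \<in> pts (tangent_atlas A)"
  then obtain p u where y: "y = (p, u)" "p \<in> pts A" "u \<in> tangent_space A p"
    by (auto simp: pts_tangent_atlas)
  have "s p u (Y p) = s p (lin_comb {1..n} (\<lambda>\<beta>. X \<beta> p) (\<lambda>\<alpha>. frame_comp n X \<alpha> (p, u))) (Y p)"
    using frame_expand[OF fr y(3)] by simp
  also have "\<dots> = (\<Sum>\<alpha>=1..n. frame_comp n X \<alpha> (p, u) * s p (X \<alpha> p) (Y p))"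
    by (intro tensor_lin_comb_left[OF A s] vector_field_tangent[OF _ y(2)] Y frame_vector_field[OF fr])
  finally show "?h y = contract s Y y"
    by (simp add: y(1) contract_def)
qed

lemma smooth_kinetic:
  fixes A :: "('p, 'e::euclidean_space) atlas"
  assumes A: "smooth_atlas A" and dim: "n = DIM('e)" and fr: "global_frame A n X"
    and s: "sym_tensor_field A s"
  shows "smooth_fun (tangent_atlas A) (pts (tangent_atlas A)) (kinetic s)"
proof (rule smooth_fun_cong[OF bundle_inj_charts[OF A] atlas_open_tangent[OF A]])
  let ?h = "\<lambda>y. (1 / 2) * (\<Sum>\<alpha>=1..n. frame_comp n X \<alpha> y * contract s (X \<alpha>) y)"
  show "smooth_fun (tangent_atlas A) (pts (tangent_atlas A)) ?h"
    by (intro smooth_fun_sum smooth_fun_mult smooth_fun_const atlas_open_tangent[OF A]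
        smooth_frame_comp[OF A dim fr] smooth_contract[OF A dim fr s] frame_vector_field[OF fr])
  fix y assume "y \<in> pts (tangent_atlas A)"
  then obtain p u where y: "y = (p, u)" "p \<in> pts A" "u \<in> tangent_space A p"
    by (auto simp: pts_tangent_atlas)
  have "s p u u = s p u (lin_comb {1..n} (\<lambda>\<beta>. X \<beta> p) (\<lambda>\<alpha>. frame_comp n X \<alpha> (p, u)))"
    using frame_expand[OF fr y(3)] by simp
  also have "\<dots> = (\<Sum>\<alpha>=1..n. frame_comp n X \<alpha> (p, u) * s p u (X \<alpha> p))"
    by (intro tensor_lin_comb_right[OF A s y(3)] vector_field_tangent[OF _ y(2)] frame_vector_field[OF fr])
  finally show "?h y = kinetic s y"
    by (simp add: y(1) contract_def kinetic_def)
qed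

section \<open>Lifts\<close>

text \<open>In a chart, with \<open>\<nu>\<close> and \<open>\<eta>\<close> the coordinate expressions of \<open>V\<close> and \<open>Y\<close>, the complete lift of
  \<open>Y\<close> at \<open>V(p)\<close> is \<open>(\<eta>, D\<eta>(\<nu>))\<close>, while the differential of the section \<open>V\<close> maps \<open>Y(p)\<close> to
  \<open>(\<eta>, D\<nu>(\<eta>))\<close>.  The difference \<open>D\<eta>(\<nu>) - D\<nu>(\<eta>)\<close> in the fibre is the coordinate expression of
  the bracket \<open>[V, Y]\<close>.\<close>
lemma complete_lift_section:
  assumes A: "smooth_atlas A" and p: "p \<in> pts A" and V: "vector_field A V" and Y: "vector_field A Y"
    and br: "lie_bracket A V Y p \<in> tangent_space A p"
    and F: "smooth_near (tangent_atlas A) (p, V p) F"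
    and FV: "smooth_near A p (\<lambda>q. F (q, V q))"
  shows "complete_lift A Y (p, V p) F = Y p (\<lambda>q. F (q, V q)) +
    deriv (\<lambda>t. F (p, \<lambda>f. V p f + t * lie_bracket A V Y p f)) 0"
proof -
  \<comment> \<open>The chart in which the complete lift is defined; everything else is computed in it as well.\<close>
  define c where "c = (SOME c. c \<in> A \<and> p \<in> fst c)"
  have "c \<in> A \<and> p \<in> fst c"
    unfolding c_def by (rule someI_ex) (use p in \<open>auto simp: pts_def\<close>)
  then obtain U \<phi> where cU: "c = (U, \<phi>)" and c: "(U, \<phi>) \<in> A" "p \<in> U"
    by (cases c) auto
  let ?B = "lie_bracket A V Y p"
  let ?D = "\<lambda>Y. frechet_derivative (local_rep (U, \<phi>) Y) (at (\<phi> p))"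
  let ?v = "vec_coords \<phi> (V p)" and ?y = "vec_coords \<phi> (Y p)" and ?b = "vec_coords \<phi> ?B"
  define G where "G = F \<circ> inv_into (bundle_dom A U) (bundle_map \<phi>)"
  define G' where "G' w = chart_vec (tangent_atlas A) (bundle_dom A U, bundle_map \<phi>) (p, V p) w F" for w
  have Vp: "V q \<in> tangent_space A q" if "q \<in> U" for q
    using vector_field_tangent[OF V, of q] that chart_dom_subset[OF c(1)] by auto
  have G: "(G has_derivative G') (at (\<phi> p, ?v))"
    using chart_vec_has_derivative[OF F, of "bundle_dom A U" "bundle_map \<phi>"] c Vp[OF c(2)]
    by (auto simp: tangent_atlas_iff G_def G'_def[abs_def] bundle_dom_def bundle_map_def)
  have GF: "G (\<phi> q, vec_coords \<phi> u) = F (q, u)" if "q \<in> U" "u \<in> tangent_space A q" for q u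
    using inv_into_f_f[OF bundle_map_inj[OF A c(1)], of "(q, u)"] that
    by (simp add: G_def bundle_dom_def bundle_map_def)
  have linG: "linear G'"
    using G has_derivative_linear by blast
  have lift: "complete_lift A Y (p, V p) F = G' (?y, ?D Y ?v)"
    unfolding complete_lift_def case_prod_conv c_def[symmetric] Let_def cU tangent_chart_eq G'_def
    using local_rep_at[OF A c, of Y] by simp
  have base: "Y p (\<lambda>q. F (q, V q)) = G' (?y, ?D V ?y)"
  proof -
    have "Y p (\<lambda>q. F (q, V q)) = chart_vec A (U, \<phi>) p ?y (\<lambda>q. F (q, V q))"
      using tangent_vec_eq[OF A c vector_field_tangent[OF Y p]] by simp
    also have "\<dots> = G' (?y, ?D V ?y)"
    proof (rule chart_vec_eqI[OF FV c])
      have "((\<lambda>x. (x, local_rep (U, \<phi>) V x)) has_derivative (\<lambda>h. (h, ?D V h))) (at (\<phi> p))"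
        by (intro has_derivative_Pair has_derivative_ident local_rep_has_derivative[OF A V c])
      then have "((\<lambda>x. G (x, local_rep (U, \<phi>) V x)) has_derivative (\<lambda>h. G' (h, ?D V h))) (at (\<phi> p))"
        by (rule has_derivative_compose) (use G local_rep_at[OF A c] in simp)
      then show "((\<lambda>q. F (q, V q)) \<circ> inv_into U \<phi> has_derivative (\<lambda>h. G' (h, ?D V h))) (at (\<phi> p))"
        using chart_open_image[OF A c(1)]
      proof (rule has_derivative_transform_within_open)
        fix x assume "x \<in> \<phi> ` U"
        then obtain q where q: "q \<in> U" "x = \<phi> q" by blast
        then show "G (x, local_rep (U, \<phi>) V x) = ((\<lambda>q. F (q, V q)) \<circ> inv_into U \<phi>) x"
          using GF[OF q(1) Vp[OF q(1)]] local_rep_at[OF A c(1) q(1)]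
            inj_chartsD[OF smooth_atlas_inj[OF A] c(1)] by simp
      qed (use c in simp)
    qed
    finally show ?thesis .
  qed
  have vert: "deriv (\<lambda>t. F (p, \<lambda>f. V p f + t * ?B f)) 0 = G' (0, ?b)"
  proof -
    have "F (p, \<lambda>f. V p f + t * ?B f) = G (\<phi> p, ?v + t *\<^sub>R ?b)" for t
      using GF[OF c(2) tangent_lin[OF A Vp[OF c(2)] br, of 1 t]] vec_coords_lin[of \<phi> 1 "V p" t ?B]
      by simp
    moreover have "((\<lambda>t. G (\<phi> p, ?v + t *\<^sub>R ?b)) has_derivative (\<lambda>t. G' (0, t *\<^sub>R ?b))) (at 0)"
    proof -
      have "((\<lambda>t. (\<phi> p, ?v + t *\<^sub>R ?b)) has_derivative (\<lambda>t. (0, t *\<^sub>R ?b))) (at (0 :: real))"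
        by (auto intro!: derivative_eq_intros)
      from has_derivative_compose[OF this, of G G'] G show ?thesis
        by simp
    qed
    moreover have "G' (0, t *\<^sub>R ?b) = G' (0, ?b) * t" for t
      using linear_scale[OF linG, of t "(0, ?b)"] by simp
    ultimately show ?thesis
      by (intro DERIV_imp_deriv) (simp add: has_field_derivative_def mult_commute_abs)
  qed
  have "G' (?y, ?D V ?y) + G' (0, ?b) = G' (?y, ?D Y ?v)"
    using linear_add[OF linG, of "(?y, ?D V ?y)" "(0, ?b)"] lie_bracket_coords[OF A V Y c] by simp
  with lift base vert show ?thesis
    by simp
qed

lemma tensor_deriv:
  assumes s: "sym_tensor_field A s" and u: "u \<in> tangent_space A p" and v: "v \<in> tangent_space A p"
    and w: "w \<in> tangent_space A p"
  shows "deriv (\<lambda>t. s p (\<lambda>f. u f + t * v f) w) 0 = s p v w"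
proof -
  have "s p (\<lambda>f. u f + t * v f) w = s p u w + t * s p v w" for t
    using tensor_lin_left[OF s u v w, of 1 t] by simp
  moreover have "((\<lambda>t. s p u w + t * s p v w) has_real_derivative s p v w) (at 0)"
    by (auto intro!: derivative_eq_intros)
  ultimately show ?thesis
    by (simp add: DERIV_imp_deriv)
qed

lemma kinetic_deriv:
  assumes A: "smooth_atlas A" and s: "sym_tensor_field A s"
    and u: "u \<in> tangent_space A p" and v: "v \<in> tangent_space A p"
  shows "deriv (\<lambda>t. kinetic s (p, \<lambda>f. u f + t * v f)) 0 = s p u v"
proof -
  have "kinetic s (p, \<lambda>f. u f + t * v f) = s p u u / 2 + t * s p u v + t\<^sup>2 * s p v v / 2" for t
  proof -
    have uv: "(\<lambda>f. u f + t * v f) \<in> tangent_space A p"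
      using tangent_lin[OF A u v, of 1 t] by simp
    have "s p (\<lambda>f. u f + t * v f) w = s p u w + t * s p v w" if "w \<in> tangent_space A p" for w
      using tensor_lin_left[OF s u v that, of 1 t] by simp
    from this[OF uv] this[OF u] this[OF v] tensor_sym[OF s uv u] tensor_sym[OF s uv v] tensor_sym[OF s u v]
    show ?thesis
      by (simp add: kinetic_def field_simps power2_eq_square)
  qed
  moreover have "((\<lambda>t. s p u u / 2 + t * s p u v + t\<^sup>2 * s p v v / 2) has_real_derivative s p u v) (at 0)"
    by (auto intro!: derivative_eq_intros)
  ultimately show ?thesis
    by (simp add: DERIV_imp_deriv)
qed

section \<open>Levi-Civita connections along fields with constant frame components\<close>

lemma levi_civita_field:
  "levi_civita A s nab \<Longrightarrow> vector_field A V \<Longrightarrow> vector_field A W \<Longrightarrow> vector_field A (nab V W)"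
  by (simp add: levi_civita_def)

lemma levi_civita_rules:
  assumes "levi_civita A s nab" and V: "vector_field A V" and W: "vector_field A W"
    and Z: "vector_field A Z" and p: "p \<in> pts A"
  shows "nab (\<lambda>q f. h * V q f + k * W q f) Z p = (\<lambda>f. h * nab V Z p f + k * nab W Z p f)"
    and "nab V (\<lambda>q f. W q f + Z q f) p = (\<lambda>f. nab V W p f + nab V Z p f)"
    and "nab V (\<lambda>q f. h * W q f) p = (\<lambda>f. V p (\<lambda>q. h) * W p f + h * nab V W p f)"
    and "lie_bracket A V W p = (\<lambda>f. nab V W p f - nab W V p f)"
    and "V p (\<lambda>q. s q (W q) (Z q)) = s p (nab V W p) (Z p) + s p (W p) (nab V Z p)"
  using assms(1)[unfolded levi_civita_def, THEN conjunct2, rule_format,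
      OF V W Z smooth_fun_const[of A "pts A" h] smooth_fun_const[of A "pts A" k] p]
  by simp_all

text \<open>Every vector \<open>v\<^sup>a X\<^sub>a(p)\<close> is extended to a field by keeping its frame components constant.  Then
  the quadratic expressions in \<open>v\<close> become single covariant derivatives and brackets.\<close>
definition const_field :: "(nat \<Rightarrow> 'p vfield) \<Rightarrow> nat set \<Rightarrow> (nat \<Rightarrow> real) \<Rightarrow> 'p vfield" where
  "const_field X I v = (\<lambda>q. lin_comb I (\<lambda>\<alpha>. X \<alpha> q) v)"

locale framed_connection =
  fixes A :: "('p, 'e::euclidean_space) atlas" and n :: nat and X :: "nat \<Rightarrow> 'p vfield"
    and s :: "'p tensor2" and nab :: "'p vfield \<Rightarrow> 'p vfield \<Rightarrow> 'p vfield"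
  assumes A: "smooth_atlas A" and dim: "n = DIM('e)" and fr: "global_frame A n X"
    and s: "sym_tensor_field A s" and lc: "levi_civita A s nab"
begin

lemma X_field: "\<alpha> \<in> {1..n} \<Longrightarrow> vector_field A (X \<alpha>)"
  using frame_vector_field[OF fr] .

lemma X_tangent: "p \<in> pts A \<Longrightarrow> \<alpha> \<in> {1..n} \<Longrightarrow> X \<alpha> p \<in> tangent_space A p"
  using vector_field_tangent[OF X_field] .

lemma const_field_field: "I \<subseteq> {1..n} \<Longrightarrow> vector_field A (const_field X I v)"
  unfolding const_field_def by (rule vector_field_lin_comb[OF A]) (use X_field in auto)

lemma const_field_tangent: "p \<in> pts A \<Longrightarrow> I \<subseteq> {1..n} \<Longrightarrow> const_field X I v p \<in> tangent_space A p"
  using vector_field_tangent[OF const_field_field] .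

lemma nab_tangent:
  "p \<in> pts A \<Longrightarrow> vector_field A V \<Longrightarrow> vector_field A W \<Longrightarrow> nab V W p \<in> tangent_space A p"
  by (intro vector_field_tangent levi_civita_field[OF lc])

lemma bracket_tangent:
  assumes p: "p \<in> pts A" and V: "vector_field A V" and W: "vector_field A W"
  shows "lie_bracket A V W p \<in> tangent_space A p"
  using tangent_lin[OF A nab_tangent[OF p V W] nab_tangent[OF p W V], of 1 "-1"]
    levi_civita_rules(4)[OF lc V W W p] by simp

lemma const_field_derivative:
  assumes p: "p \<in> pts A" and I: "I \<subseteq> {1..n}" and Y: "vector_field A Y"
  shows "const_field X I v p (\<lambda>q. s q (const_field X I v q) (Y q)) =
    (\<Sum>a\<in>I. \<Sum>b\<in>I. X a p (\<lambda>q. s q (X b q) (Y q)) * v a * v b)"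
proof -
  have "X a p (\<lambda>q. s q (const_field X I v q) (Y q)) = (\<Sum>b\<in>I. v b * X a p (\<lambda>q. s q (X b q) (Y q)))"
    if a: "a \<in> I" for a
  proof -
    have a': "X a p \<in> tangent_space A p"
      using X_tangent[OF p] a I by auto
    have "X a p (\<lambda>q. s q (const_field X I v q) (Y q)) = X a p (\<lambda>q. \<Sum>b\<in>I. v b * s q (X b q) (Y q))"
    proof (rule tangent_cong[OF smooth_atlas_inj[OF A] a' atlas_open_pts[OF A] p])
      fix q assume q: "q \<in> pts A"
      show "s q (const_field X I v q) (Y q) = (\<Sum>b\<in>I. v b * s q (X b q) (Y q))"
        unfolding const_field_def
        by (rule tensor_lin_comb_left[OF A s vector_field_tangent[OF Y q]])
           (use X_tangent[OF q] I in auto)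
    qed
    also have "\<dots> = (\<Sum>b\<in>I. v b * X a p (\<lambda>q. s q (X b q) (Y q)))"
      by (rule tangent_sum_fun[OF smooth_atlas_inj[OF A] a' atlas_open_pts[OF A] p])
         (use tensor_smooth[OF s X_field Y] I in auto)
    finally show ?thesis .
  qed
  then show ?thesis
    by (subst const_field_def) (simp add: lin_comb_def sum_distrib_left ac_simps cong: sum.cong)
qed

lemma acceleration_frame:
  assumes p: "p \<in> pts A" and I: "I \<subseteq> {1..n}"
  shows "nab (const_field X I v) (const_field X I v) p =
    lin_comb {1..n} (\<lambda>\<gamma>. X \<gamma> p) (\<lambda>\<gamma>. \<Sum>a\<in>I. \<Sum>b\<in>I. christoffel n X nab \<gamma> a b p * v a * v b)"
proof -
  have left: "nab (const_field X J v) W p = lin_comb J (\<lambda>a. nab (X a) W p) v"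
    if "finite J" "J \<subseteq> {1..n}" and W: "vector_field A W" for J W
    using that(1,2)
  proof (induction J)
    case empty
    show ?case
      using levi_civita_rules(1)[OF lc W W W p, of 0 0] by (simp add: const_field_def lin_comb_def)
  next
    case (insert a J)
    have "const_field X (insert a J) v = (\<lambda>q f. v a * X a q f + 1 * const_field X J v q f)"
      using insert by (auto simp: const_field_def lin_comb_def)
    then have "nab (const_field X (insert a J) v) W p =
        (\<lambda>f. v a * nab (X a) W p f + 1 * nab (const_field X J v) W p f)"
      using levi_civita_rules(1)[OF lc X_field[of a] const_field_field[of J v] W p, where h = "v a" and k = 1] insert
      by simp
    then show ?case
      using insert by (simp add: lin_comb_def)
  qed
  have right: "nab W (const_field X J v) p = lin_comb J (\<lambda>b. nab W (X b) p) v"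
    if "finite J" "J \<subseteq> {1..n}" and W: "vector_field A W" for J W
    using that(1,2)
  proof (induction J)
    case empty
    have "W p (\<lambda>q. 0) = 0"
      by (rule tangent_const_fun[OF vector_field_tangent[OF W p] atlas_open_pts[OF A] p])
    then show ?case
      using levi_civita_rules(3)[OF lc W W W p, of 0] by (simp add: const_field_def lin_comb_def)
  next
    case (insert b J)
    then have b: "vector_field A (X b)"
      using X_field by simp
    have J: "vector_field A (const_field X J v)"
      using const_field_field insert by simp
    have vb: "vector_field A (\<lambda>q f. v b * X b q f)"
      using vector_field_lin_comb[OF A, of "{b}" X v] b by (simp add: lin_comb_def)
    have "W p (\<lambda>q. v b) = 0"
      by (rule tangent_const_fun[OF vector_field_tangent[OF W p] atlas_open_pts[OF A] p])
    then have "nab W (\<lambda>q f. v b * X b q f) p = (\<lambda>f. v b * nab W (X b) p f)"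
      using levi_civita_rules(3)[OF lc W b b p, of "v b"] by simp
    moreover have "const_field X (insert b J) v = (\<lambda>q f. v b * X b q f + const_field X J v q f)"
      using insert by (auto simp: const_field_def lin_comb_def)
    ultimately have "nab W (const_field X (insert b J) v) p =
        (\<lambda>f. v b * nab W (X b) p f + nab W (const_field X J v) p f)"
      using levi_civita_rules(2)[OF lc W vb J p] by simp
    then show ?case
      using insert by (simp add: lin_comb_def)
  qed
  have fin: "finite I"
    using I finite_subset by blast
  have chr: "nab (X a) (X b) p f = (\<Sum>\<gamma>=1..n. christoffel n X nab \<gamma> a b p * X \<gamma> p f)"
    if "a \<in> I" "b \<in> I" for a b f
    using frame_expand[OF fr nab_tangent[OF p X_field X_field], of a b] that I
    by (subst frame_expand[OF fr nab_tangent[OF p X_field X_field], of a b])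
       (auto simp: lin_comb_def christoffel_def)
  show ?thesis
  proof
    fix f
    have "nab (const_field X I v) (const_field X I v) p f =
        (\<Sum>a\<in>I. \<Sum>b\<in>I. v a * v b * nab (X a) (X b) p f)"
      using left[OF fin I const_field_field[OF I]] right[OF fin I X_field] I
      by (simp add: lin_comb_def sum_distrib_left mult.assoc subset_iff)
    also have "\<dots> = (\<Sum>a\<in>I. \<Sum>b\<in>I. \<Sum>\<gamma>=1..n. christoffel n X nab \<gamma> a b p * v a * v b * X \<gamma> p f)"
      using chr by (simp add: sum_distrib_left ac_simps)
    also have "\<dots> = (\<Sum>\<gamma>=1..n. \<Sum>a\<in>I. \<Sum>b\<in>I. christoffel n X nab \<gamma> a b p * v a * v b * X \<gamma> p f)"
      by (subst sum.swap, subst sum.swap, rule refl)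
    also have "\<dots> = lin_comb {1..n} (\<lambda>\<gamma>. X \<gamma> p)
        (\<lambda>\<gamma>. \<Sum>a\<in>I. \<Sum>b\<in>I. christoffel n X nab \<gamma> a b p * v a * v b) f"
      by (simp add: lin_comb_def sum_distrib_right)
    finally show "nab (const_field X I v) (const_field X I v) p f = \<dots>" .
  qed
qed

lemma bracket_frame:
  assumes p: "p \<in> pts A" and "\<alpha> \<in> {1..n}" "\<beta> \<in> {1..n}"
  shows "lie_bracket A (X \<alpha>) (X \<beta>) p = lin_comb {1..n} (\<lambda>\<gamma>. X \<gamma> p) (\<lambda>\<gamma>. structure_fun A n X \<gamma> \<alpha> \<beta> p)"
  unfolding structure_fun_def
  by (rule frame_expand[OF fr bracket_tangent[OF p X_field X_field]]) (use assms in auto)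

lemma lie_bracket_anti: "lie_bracket A V W p f = - lie_bracket A W V p f"
  by (simp add: lie_bracket_def)

lemma structure_fun_anti:
  assumes p: "p \<in> pts A" and \<alpha>: "\<alpha> \<in> {1..n}" and \<beta>: "\<beta> \<in> {1..n}" and \<gamma>: "\<gamma> \<in> {1..n}"
  shows "structure_fun A n X \<gamma> \<beta> \<alpha> p = - structure_fun A n X \<gamma> \<alpha> \<beta> p"
proof -
  have "lie_bracket A (X \<beta>) (X \<alpha>) p = (\<lambda>f. - lie_bracket A (X \<alpha>) (X \<beta>) p f)"
    using lie_bracket_anti by blast
  also have "\<dots> = lin_comb {1..n} (\<lambda>\<gamma>. X \<gamma> p) (\<lambda>\<gamma>. - structure_fun A n X \<gamma> \<alpha> \<beta> p)"
    unfolding bracket_frame[OF p \<alpha> \<beta>] by (simp add: lin_comb_def sum_negf)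
  finally show ?thesis
    unfolding structure_fun_def[of A n X \<gamma> \<beta> \<alpha>]
    using frame_comp_lin_comb[OF A fr p order_refl, of \<gamma>] \<gamma> by simp
qed

lemma bracket_term:
  assumes p: "p \<in> pts A" and I: "I \<subseteq> {1..n}" and \<delta>: "\<delta> \<in> {1..n}"
  shows "s p (const_field X I v p) (lie_bracket A (const_field X I v) (X \<delta>) p) =
    (\<Sum>a\<in>I. \<Sum>b\<in>I. (\<Sum>\<gamma>=1..n. s p (X b p) (X \<gamma> p) * structure_fun A n X \<gamma> a \<delta> p) * v a * v b)"
proof -
  have Xa: "a \<in> {1..n}" if "a \<in> I" for a
    using that I by auto
  have "lie_bracket A (const_field X I v) (X \<delta>) p = lin_comb I (\<lambda>a. lie_bracket A (X a) (X \<delta>) p) v"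
    unfolding const_field_def
    by (rule lie_bracket_lin_comb[OF A p X_field[OF Xa] X_field[OF \<delta>] bracket_tangent[OF p]])
  then have "s p (const_field X I v p) (lie_bracket A (const_field X I v) (X \<delta>) p) =
      (\<Sum>a\<in>I. v a * s p (const_field X I v p) (lie_bracket A (X a) (X \<delta>) p))"
    using tensor_lin_comb_right[OF A s const_field_tangent[OF p I] bracket_tangent[OF p X_field[OF Xa] X_field[OF \<delta>]]]
    by simp
  also have "\<dots> = (\<Sum>a\<in>I. v a * (\<Sum>\<gamma>=1..n. structure_fun A n X \<gamma> a \<delta> p * s p (const_field X I v p) (X \<gamma> p)))"
  proof (rule sum.cong[OF refl])
    fix a assume a: "a \<in> I"
    show "v a * s p (const_field X I v p) (lie_bracket A (X a) (X \<delta>) p) =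
      v a * (\<Sum>\<gamma>=1..n. structure_fun A n X \<gamma> a \<delta> p * s p (const_field X I v p) (X \<gamma> p))"
      unfolding bracket_frame[OF p Xa[OF a] \<delta>]
      using tensor_lin_comb_right[OF A s const_field_tangent[OF p I] X_tangent[OF p],
          of "{1..n}" "\<lambda>\<gamma>. \<gamma>" v "\<lambda>\<gamma>. structure_fun A n X \<gamma> a \<delta> p"] by simp
  qed
  also have "\<dots> = (\<Sum>a\<in>I. v a * (\<Sum>\<gamma>=1..n. structure_fun A n X \<gamma> a \<delta> p * (\<Sum>b\<in>I. v b * s p (X b p) (X \<gamma> p))))"
  proof (intro sum.cong refl arg_cong2[of _ _ _ _ "(*)"])
    fix \<gamma> assume \<gamma>: "\<gamma> \<in> {1..n}"
    show "s p (const_field X I v p) (X \<gamma> p) = (\<Sum>b\<in>I. v b * s p (X b p) (X \<gamma> p))"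
      unfolding const_field_def
      by (rule tensor_lin_comb_left[OF A s X_tangent[OF p \<gamma>] X_tangent[OF p Xa]])
  qed
  also have "\<dots> = (\<Sum>a\<in>I. \<Sum>b\<in>I. (\<Sum>\<gamma>=1..n. s p (X b p) (X \<gamma> p) * structure_fun A n X \<gamma> a \<delta> p) * v a * v b)"
  proof (rule sum.cong[OF refl])
    fix a
    show "v a * (\<Sum>\<gamma>=1..n. structure_fun A n X \<gamma> a \<delta> p * (\<Sum>b\<in>I. v b * s p (X b p) (X \<gamma> p))) =
      (\<Sum>b\<in>I. (\<Sum>\<gamma>=1..n. s p (X b p) (X \<gamma> p) * structure_fun A n X \<gamma> a \<delta> p) * v a * v b)"
      unfolding sum_distrib_left sum_distrib_right
      by (subst sum.swap) (simp add: ac_simps)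
  qed
  finally show ?thesis .
qed

lemma kinetic_section_smooth:
  assumes V: "vector_field A V"
  shows "smooth_fun A (pts A) (\<lambda>q. kinetic s (q, V q))"
  using smooth_fun_mult[OF atlas_open_pts[OF A] smooth_fun_const tensor_smooth[OF s V V], of "1/2"]
  by (simp add: kinetic_def)

text \<open>The Koszul formula for \<open>\<nabla>\<^sub>V V\<close>.  By compatibility with the metric the first two
  terms on the right are \<open>s(\<nabla>\<^sub>V V, Y) + s(V, \<nabla>\<^sub>V Y)\<close> and \<open>s(V, \<nabla>\<^sub>Y V)\<close>, and the
  bracket cancels what is left.\<close>
lemma acceleration_koszul:
  assumes p: "p \<in> pts A" and V: "vector_field A V" and Y: "vector_field A Y"
  shows "s p (nab V V p) (Y p) = V p (\<lambda>q. s q (V q) (Y q)) - Y p (\<lambda>q. kinetic s (q, V q))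
    - s p (V p) (lie_bracket A V Y p)"
proof -
  note T = vector_field_tangent[OF V p] vector_field_tangent[OF Y p]
    nab_tangent[OF p V V] nab_tangent[OF p V Y] nab_tangent[OF p Y V]
  \<comment> \<open>The factor one half of the kinetic energy, as an instance of linearity.\<close>
  have "Y p (\<lambda>q. (1/2) * s q (V q) (V q) + 0 * s q (V q) (V q)) = 1/2 * Y p (\<lambda>q. s q (V q) (V q)) + 0 * Y p (\<lambda>q. s q (V q) (V q))"
    using smooth_nearI[OF atlas_open_pts[OF A] p tensor_smooth[OF s V V]]
    by (intro tangent_lin_fun[OF smooth_atlas_inj[OF A] T(2)])
  then have "Y p (\<lambda>q. kinetic s (q, V q)) = s p (V p) (nab Y V p)"
    using levi_civita_rules(5)[OF lc Y V V p] tensor_sym[OF s T(1) T(5)] by (simp add: kinetic_def)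
  moreover have "s p (V p) (lie_bracket A V Y p) = s p (V p) (nab V Y p) - s p (V p) (nab Y V p)"
    using tensor_lin_left[OF s T(4,5,1), of 1 "-1"] levi_civita_rules(4)[OF lc V Y Y p]
      tensor_sym[OF s T(1) bracket_tangent[OF p V Y]] tensor_sym[OF s T(1,4)] tensor_sym[OF s T(1,5)]
    by simp
  ultimately show ?thesis
    using levi_civita_rules(5)[OF lc V V Y p] by simp
qed

lemma contract_smooth_near:
  assumes "vector_field A Y" "u \<in> tangent_space A p"
  shows "smooth_near (tangent_atlas A) (p, u) (contract s Y)"
  using smooth_near_tangent[OF A smooth_contract[OF A dim fr s]] assms .

lemma kinetic_smooth_near:
  "u \<in> tangent_space A p \<Longrightarrow> smooth_near (tangent_atlas A) (p, u) (kinetic s)"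
  using smooth_near_tangent[OF A smooth_kinetic[OF A dim fr s]] .

lemma vertical_lift_contract:
  assumes V: "vector_field A V" and Y: "vector_field A Y" and u: "u \<in> tangent_space A p"
  shows "vertical_lift A V (p, u) (contract s Y) = s p (V p) (Y p)"
  using contract_smooth_near[OF Y u] tangent_pts[OF u]
    tensor_deriv[OF s u vector_field_tangent[OF V] vector_field_tangent[OF Y]]
  by (simp add: vertical_lift_def contract_def)

lemma vertical_lift_kinetic:
  assumes V: "vector_field A V" and u: "u \<in> tangent_space A p"
  shows "vertical_lift A V (p, u) (kinetic s) = s p u (V p)"
  using kinetic_smooth_near[OF u] tangent_pts[OF u] kinetic_deriv[OF A s u vector_field_tangent[OF V]]
  by (simp add: vertical_lift_def)

lemma complete_lift_contract:
  assumes p: "p \<in> pts A" and V: "vector_field A V" and W: "vector_field A W" and Y: "vector_field A Y"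
  shows "complete_lift A W (p, V p) (contract s Y) =
    W p (\<lambda>q. s q (V q) (Y q)) + s p (lie_bracket A V W p) (Y p)"
  using complete_lift_section[OF A p V W bracket_tangent[OF p V W] contract_smooth_near[OF Y vector_field_tangent[OF V p]]]
    smooth_nearI[OF atlas_open_pts[OF A] p tensor_smooth[OF s V Y]]
    tensor_deriv[OF s vector_field_tangent[OF V p] bracket_tangent[OF p V W] vector_field_tangent[OF Y p]]
  by (simp add: contract_def)

lemma complete_lift_kinetic:
  assumes p: "p \<in> pts A" and V: "vector_field A V" and W: "vector_field A W"
  shows "complete_lift A W (p, V p) (kinetic s) =
    W p (\<lambda>q. kinetic s (q, V q)) + s p (V p) (lie_bracket A V W p)"
  using complete_lift_section[OF A p V W bracket_tangent[OF p V W] kinetic_smooth_near[OF vector_field_tangent[OF V p]]]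
    smooth_nearI[OF atlas_open_pts[OF A] p kinetic_section_smooth[OF V]]
    kinetic_deriv[OF A s vector_field_tangent[OF V p] bracket_tangent[OF p V W]]
  by simp

text \<open>Summing the complete lifts with coefficients \<open>v\<^sup>a\<close> gives the complete lift of \<open>V\<close> at
  \<open>V(p)\<close>, which is the image of \<open>V(p)\<close> under the differential of the section \<open>V\<close>; the bracket
  terms add up to \<open>[V, V] = 0\<close>.\<close>
lemma second_order_contract:
  fixes v F :: "nat \<Rightarrow> real"
  assumes p: "p \<in> pts A" and I: "I \<subseteq> {1..n}" and Y: "vector_field A Y"
  defines "V \<equiv> const_field X I v"
  shows "(\<Sum>a\<in>I. v a * complete_lift A (X a) (p, V p) (contract s Y)
      + F a * vertical_lift A (X a) (p, V p) (contract s Y)) =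
    V p (\<lambda>q. s q (V q) (Y q)) + (\<Sum>a\<in>I. F a * s p (X a p) (Y p))"
proof -
  have Xa: "vector_field A (X a)" if "a \<in> I" for a
    using X_field that I by auto
  have V: "vector_field A V"
    unfolding V_def by (rule const_field_field[OF I])
  note VT = vector_field_tangent[OF V p] and YT = vector_field_tangent[OF Y p]
  have "(\<Sum>a\<in>I. v a * s p (lie_bracket A (X a) V p) (Y p)) = s p (lie_bracket A V V p) (Y p)"
    using tensor_lin_comb_left[OF A s YT bracket_tangent[OF p Xa V], of I "\<lambda>a. a" v]
      lie_bracket_lin_comb[OF A p Xa V bracket_tangent[OF p], where I = I and v = v]
    by (simp add: V_def const_field_def)
  also have "lie_bracket A V V p = (\<lambda>f. 0)"
    by (auto simp: lie_bracket_def)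
  finally have z: "(\<Sum>a\<in>I. v a * s p (lie_bracket A (X a) V p) (Y p)) = 0"
    using tensor_zero_left[OF s YT] by simp
  have anti: "s p (lie_bracket A V (X a) p) (Y p) = - s p (lie_bracket A (X a) V p) (Y p)" if "a \<in> I" for a
  proof -
    have "lie_bracket A V (X a) p = (\<lambda>f. (-1) * lie_bracket A (X a) V p f + 0 * lie_bracket A (X a) V p f)"
      using lie_bracket_anti[of V "X a"] by auto
    then show ?thesis
      using tensor_lin_left[OF s bracket_tangent[OF p Xa[OF that] V] bracket_tangent[OF p Xa[OF that] V] YT, of "-1" 0]
      by simp
  qed
  have "(\<Sum>a\<in>I. v a * complete_lift A (X a) (p, V p) (contract s Y)
      + F a * vertical_lift A (X a) (p, V p) (contract s Y)) =
    (\<Sum>a\<in>I. v a * X a p (\<lambda>q. s q (V q) (Y q)) - v a * s p (lie_bracket A (X a) V p) (Y p)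
      + F a * s p (X a p) (Y p))"
  proof (rule sum.cong[OF refl])
    fix a assume a: "a \<in> I"
    show "v a * complete_lift A (X a) (p, V p) (contract s Y)
        + F a * vertical_lift A (X a) (p, V p) (contract s Y) =
      v a * X a p (\<lambda>q. s q (V q) (Y q)) - v a * s p (lie_bracket A (X a) V p) (Y p)
        + F a * s p (X a p) (Y p)"
      unfolding complete_lift_contract[OF p V Xa[OF a] Y] vertical_lift_contract[OF Xa[OF a] Y VT] anti[OF a]
      by (simp add: algebra_simps)
  qed
  also have "\<dots> = (\<Sum>a\<in>I. v a * X a p (\<lambda>q. s q (V q) (Y q))) + (\<Sum>a\<in>I. F a * s p (X a p) (Y p))"
    by (simp add: sum.distrib sum_subtractf z)
  also have "(\<Sum>a\<in>I. v a * X a p (\<lambda>q. s q (V q) (Y q))) = V p (\<lambda>q. s q (V q) (Y q))"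
    by (simp add: V_def const_field_def lin_comb_def)
  finally show ?thesis .
qed

end

text \<open>Two local extensions of a function on \<open>C\<close> differ by one that vanishes on \<open>C\<close>, and this is annihilated
  by vectors tangent to \<open>C\<close>.\<close>
lemma sub_apply_eq:
  assumes B: "inj_charts B" and x: "Z x \<in> sub_tangent_space B C x" and H: "local_ext B C x h H"
  shows "sub_apply B C Z h x = Z x H"
  unfolding sub_apply_def
proof (rule the_equality)
  show "\<exists>H'. local_ext B C x h H' \<and> Z x H = Z x H'"
    using H by blast
next
  fix r assume "\<exists>H. local_ext B C x h H \<and> r = Z x H"
  then obtain H' where H': "local_ext B C x h H'" "r = Z x H'"
    by blast
  obtain V W where VW: "atlas_open B V" "x \<in> V" "\<And>y. y \<in> V \<Longrightarrow> y \<in> C \<Longrightarrow> H y = h y"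
      "atlas_open B W" "x \<in> W" "\<And>y. y \<in> W \<Longrightarrow> y \<in> C \<Longrightarrow> H' y = h y"
    using H H' unfolding local_ext_def near_def by blast
  have sm: "smooth_near B x H" "smooth_near B x H'"
    using H H' by (auto simp: local_ext_def)
  \<comment> \<open>The difference is written with coefficients \<open>1\<close> and \<open>-1\<close> to fit linearity of tangent vectors.\<close>
  have "local_ext B C x (\<lambda>y. 0) (\<lambda>y. 1 * H y + (- 1) * H' y)"
    unfolding local_ext_def near_def
    by (intro conjI smooth_near_lin[OF B sm] exI[of _ "V \<inter> W"] atlas_open_Int[OF B VW(1,4)])
       (use VW in auto)
  then have "Z x (\<lambda>y. 1 * H y + (- 1) * H' y) = 0"
    using x by (auto simp: sub_tangent_space_def)
  moreover have "Z x \<in> tangent_space B x"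
    using x by (simp add: sub_tangent_space_def)
  ultimately show "r = Z x H"
    using tangent_lin_fun[OF B _ sm, of "Z x" 1 "-1"] H'(2) by simp
qed

section \<open>Metrics that agree on the distribution\<close>

text \<open>Keeps the index sets \<open>{1..m}\<close> and \<open>{m + 1..n}\<close> in the form in which the sums are split.\<close>
declare One_nat_def [simp del]

lemma sum_split_rank:
  fixes f :: "nat \<Rightarrow> real"
  assumes "m \<le> n"
  shows "(\<Sum>\<gamma>=1..n. f \<gamma>) = (\<Sum>d=1..m. f d) + (\<Sum>k=m+1..n. f k)"
proof -
  have "{1..n} = {1..m} \<union> {m+1..n}" "{1..m} \<inter> {m+1..n} = {}"
    using assms by auto
  then show ?thesis
    by (simp add: sum.union_disjoint)
qed

lemma sum_quadratic_contract:
  fixes w :: "nat \<Rightarrow> real"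
  shows "(\<Sum>a\<in>I. \<Sum>b\<in>J. (\<Sum>d\<in>K. w d * \<Gamma> d a b) * v a * v b) =
    (\<Sum>d\<in>K. (\<Sum>a\<in>I. \<Sum>b\<in>J. \<Gamma> d a b * v a * v b) * w d)"
proof -
  have "(\<Sum>a\<in>I. \<Sum>b\<in>J. (\<Sum>d\<in>K. w d * \<Gamma> d a b) * v a * v b) =
      (\<Sum>a\<in>I. \<Sum>b\<in>J. \<Sum>d\<in>K. \<Gamma> d a b * v a * v b * w d)"
    by (simp add: sum_distrib_left sum_distrib_right ac_simps)
  also have "\<dots> = (\<Sum>a\<in>I. \<Sum>d\<in>K. \<Sum>b\<in>J. \<Gamma> d a b * v a * v b * w d)"
    by (intro sum.cong refl sum.swap)
  also have "\<dots> = (\<Sum>d\<in>K. \<Sum>a\<in>I. \<Sum>b\<in>J. \<Gamma> d a b * v a * v b * w d)"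
    by (rule sum.swap)
  finally show ?thesis
    by (simp add: sum_distrib_right)
qed

text \<open>The frame component \<open>\<Gamma>\<^sup>\<gamma>\<^sub>a\<^sub>b v\<^sup>a v\<^sup>b\<close> of \<open>\<nabla>\<^sub>V V\<close>.\<close>
definition acceleration ::
    "nat \<Rightarrow> (nat \<Rightarrow> 'p vfield) \<Rightarrow> ('p vfield \<Rightarrow> 'p vfield \<Rightarrow> 'p vfield) \<Rightarrow> nat \<Rightarrow> nat \<Rightarrow>
      (nat \<Rightarrow> real) \<Rightarrow> 'p \<Rightarrow> real" where
  "acceleration n X nab m \<gamma> v p = (\<Sum>a=1..m. \<Sum>b=1..m. christoffel n X nab \<gamma> a b p * v a * v b)"

lemma (in framed_connection) tensor_acceleration:
  assumes p: "p \<in> pts A" and m: "m \<le> n" and \<delta>: "\<delta> \<in> {1..n}"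
  shows "s p (nab (const_field X {1..m} v) (const_field X {1..m} v) p) (X \<delta> p) =
    (\<Sum>\<gamma>=1..n. acceleration n X nab m \<gamma> v p * s p (X \<gamma> p) (X \<delta> p))"
proof -
  have "{1..m} \<subseteq> {1..n}"
    using m by auto
  then have "nab (const_field X {1..m} v) (const_field X {1..m} v) p =
      lin_comb {1..n} (\<lambda>\<gamma>. X \<gamma> p) (\<lambda>\<gamma>. acceleration n X nab m \<gamma> v p)"
    using acceleration_frame[OF p] by (simp add: acceleration_def)
  then show ?thesis
    using tensor_lin_comb_left[OF A s X_tangent[OF p \<delta>] X_tangent[OF p],
        of "{1..n}" "\<lambda>\<gamma>. \<gamma>" "\<lambda>\<gamma>. acceleration n X nab m \<gamma> v p"] by simp
qed

text \<open>The frame is adapted to the splitting into the distribution, spanned by the first \<open>m\<close> fields, and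
  its \<open>g\<close>-orthogonal complement.\<close>
locale preserving_pair =
  G: framed_connection A n X g nab + H: framed_connection A n X gh nabh
  for A :: "('p, 'e::euclidean_space) atlas" and n :: nat and X :: "nat \<Rightarrow> 'p vfield"
    and g :: "'p tensor2" and nab and gh :: "'p tensor2" and nabh +
  fixes m :: nat
  assumes m: "m \<le> n"
    and gab: "p \<in> pts A \<Longrightarrow> a \<in> {1..m} \<Longrightarrow> b \<in> {1..m} \<Longrightarrow> gh p (X a p) (X b p) = g p (X a p) (X b p)"
    and gai: "p \<in> pts A \<Longrightarrow> a \<in> {1..m} \<Longrightarrow> i \<in> {m+1..n} \<Longrightarrow> g p (X a p) (X i p) = 0"
begin

abbreviation field :: "(nat \<Rightarrow> real) \<Rightarrow> 'p vfield" where
  "field v \<equiv> const_field X {1..m} v"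

abbreviation accel :: "nat \<Rightarrow> (nat \<Rightarrow> real) \<Rightarrow> 'p \<Rightarrow> real" where
  "accel \<equiv> acceleration n X nab m"

abbreviation accelh :: "nat \<Rightarrow> (nat \<Rightarrow> real) \<Rightarrow> 'p \<Rightarrow> real" where
  "accelh \<equiv> acceleration n X nabh m"

text \<open>For \<open>\<delta> \<le> m\<close> this is the left side of (A), and for \<open>\<delta> > m\<close> the last term of (B).\<close>
definition bracket_defect :: "nat \<Rightarrow> (nat \<Rightarrow> real) \<Rightarrow> 'p \<Rightarrow> real" where
  "bracket_defect \<delta> v p = (\<Sum>a=1..m. \<Sum>b=1..m. \<Sum>k=m+1..n.
     gh p (X b p) (X k p) * structure_fun A n X k a \<delta> p * v a * v b)"

definition cross_derivative :: "nat \<Rightarrow> (nat \<Rightarrow> real) \<Rightarrow> 'p \<Rightarrow> real" where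
  "cross_derivative i v p = (\<Sum>a=1..m. \<Sum>b=1..m. X a p (\<lambda>q. gh q (X b q) (X i q)) * v a * v b)"

lemma sub_m: "{1..m} \<subseteq> {1..n}"
  using m by auto

lemma in_m: "a \<in> {1..m} \<Longrightarrow> a \<in> {1..n}" "i \<in> {m+1..n} \<Longrightarrow> i \<in> {1..n}"
  using m by auto

text \<open>The metrics differ on the pair of \<open>X\<^sub>b\<close> and \<open>X\<^sub>\<gamma>\<close> only if \<open>\<gamma> > m\<close>, and there \<open>g\<close> vanishes.\<close>
lemma bracket_defect_bracket:
  assumes p: "p \<in> pts A" and \<delta>: "\<delta> \<in> {1..n}"
  shows "gh p (field v p) (lie_bracket A (field v) (X \<delta>) p) =
    g p (field v p) (lie_bracket A (field v) (X \<delta>) p) + bracket_defect \<delta> v p"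
proof -
  have "(\<Sum>\<gamma>=1..n. gh p (X b p) (X \<gamma> p) * structure_fun A n X \<gamma> a \<delta> p) =
      (\<Sum>\<gamma>=1..n. g p (X b p) (X \<gamma> p) * structure_fun A n X \<gamma> a \<delta> p) +
      (\<Sum>k=m+1..n. gh p (X b p) (X k p) * structure_fun A n X k a \<delta> p)" if b: "b \<in> {1..m}" for a b
  proof -
    have "(\<Sum>d=1..m. gh p (X b p) (X d p) * structure_fun A n X d a \<delta> p) =
        (\<Sum>d=1..m. g p (X b p) (X d p) * structure_fun A n X d a \<delta> p)"
      using gab[OF p b] by simp
    moreover have "(\<Sum>k=m+1..n. g p (X b p) (X k p) * structure_fun A n X k a \<delta> p) = 0"
      using gai[OF p b] by simp
    ultimately show ?thesis
      by (simp add: sum_split_rank[OF m])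
  qed
  then show ?thesis
    unfolding G.bracket_term[OF p sub_m \<delta>] H.bracket_term[OF p sub_m \<delta>] bracket_defect_def
      sum.distrib[symmetric]
    by (intro sum.cong refl) (simp add: algebra_simps sum_distrib_left)
qed

lemma field_eq_on_D:
  assumes p: "p \<in> pts A" and c: "c \<in> {1..m}"
  shows "gh p (field v p) (X c p) = g p (field v p) (X c p)"
proof -
  have exp: "s p (field v p) (X c p) = (\<Sum>a=1..m. v a * s p (X a p) (X c p))" if "sym_tensor_field A s" for s
    unfolding const_field_def
    by (rule tensor_lin_comb_left[OF G.A that G.X_tangent[OF p in_m(1)[OF c]] G.X_tangent[OF p in_m(1)]])
  show ?thesis
    unfolding exp[OF G.s] exp[OF H.s] using gab[OF p _ c] by simp
qed

lemma field_orth: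
  assumes p: "p \<in> pts A" and i: "i \<in> {m+1..n}"
  shows "g p (field v p) (X i p) = 0"
  unfolding const_field_def
  using tensor_lin_comb_left[OF G.A G.s G.X_tangent[OF p in_m(2)[OF i]] G.X_tangent[OF p in_m(1)],
      of "{1..m}" "\<lambda>a. a" v] gai[OF p _ i] by simp

lemma field_kinetic_eq:
  assumes p: "p \<in> pts A"
  shows "kinetic gh (p, field v p) = kinetic g (p, field v p)"
proof -
  have exp: "s p (field v p) (field v p) = (\<Sum>a=1..m. v a * s p (field v p) (X a p))"
    if "sym_tensor_field A s" for s
    using tensor_lin_comb_right[OF G.A that G.const_field_tangent[OF p sub_m] G.X_tangent[OF p in_m(1)],
        of "{1..m}" "\<lambda>a. a" v v] by (simp add: const_field_def)
  show ?thesis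
    using exp[OF G.s] exp[OF H.s] field_eq_on_D[OF p] by (simp add: kinetic_def)
qed

lemma tangent_cong_pts:
  assumes p: "p \<in> pts A" and Y: "vector_field A Y" and eq: "\<And>q. q \<in> pts A \<Longrightarrow> f q = h q"
  shows "Y p f = Y p h"
  using tangent_cong[of A "Y p" p "pts A" f h] smooth_atlas_inj[OF G.A] vector_field_tangent[OF Y p]
    atlas_open_pts[OF G.A] p eq by blast

text \<open>The kinetic energy term of the Koszul formula is the same for both metrics and drops out.\<close>
lemma koszul_difference:
  assumes p: "p \<in> pts A" and \<delta>: "\<delta> \<in> {1..n}"
  shows "gh p (nabh (field v) (field v) p) (X \<delta> p) - g p (nab (field v) (field v) p) (X \<delta> p) =
    field v p (\<lambda>q. gh q (field v q) (X \<delta> q)) - field v p (\<lambda>q. g q (field v q) (X \<delta> q)) - bracket_defect \<delta> v p"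
proof -
  have "X \<delta> p (\<lambda>q. kinetic gh (q, field v q)) = X \<delta> p (\<lambda>q. kinetic g (q, field v q))"
    by (rule tangent_cong_pts[OF p G.X_field[OF \<delta>] field_kinetic_eq])
  then show ?thesis
    using G.acceleration_koszul[OF p G.const_field_field[OF sub_m] G.X_field[OF \<delta>], of v]
      H.acceleration_koszul[OF p G.const_field_field[OF sub_m] G.X_field[OF \<delta>], of v]
      bracket_defect_bracket[OF p \<delta>, of v]
    by simp
qed

lemma accel_horizontal:
  assumes p: "p \<in> pts A" and c: "c \<in> {1..m}"
  shows "g p (nab (field v) (field v) p) (X c p) = (\<Sum>d=1..m. accel d v p * g p (X d p) (X c p))"
proof -
  have "(\<Sum>k=m+1..n. accel k v p * g p (X k p) (X c p)) = 0"
    using tensor_sym[OF G.s G.X_tangent[OF p in_m(2)] G.X_tangent[OF p in_m(1)[OF c]]] gai[OF p c]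
    by simp
  then show ?thesis
    by (simp add: G.tensor_acceleration[OF p m in_m(1)[OF c]] sum_split_rank[OF m])
qed

lemma accel_vertical:
  assumes p: "p \<in> pts A" and i: "i \<in> {m+1..n}"
  shows "g p (nab (field v) (field v) p) (X i p) = (\<Sum>k=m+1..n. accel k v p * g p (X k p) (X i p))"
proof -
  have "(\<Sum>d=1..m. accel d v p * g p (X d p) (X i p)) = 0"
    using gai[OF p _ i] by simp
  then show ?thesis
    by (simp add: G.tensor_acceleration[OF p m in_m(2)[OF i]] sum_split_rank[OF m])
qed

lemma accelh_horizontal:
  assumes p: "p \<in> pts A" and c: "c \<in> {1..m}"
  shows "(\<Sum>\<gamma>=1..n. accelh \<gamma> v p * gh p (X \<gamma> p) (X c p)) =
    (\<Sum>d=1..m. accel d v p * gh p (X d p) (X c p)) - bracket_defect c v p"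
proof -
  have "field v p (\<lambda>q. gh q (field v q) (X c q)) = field v p (\<lambda>q. g q (field v q) (X c q))"
    by (rule tangent_cong_pts[OF p G.const_field_field[OF sub_m] field_eq_on_D[OF _ c]])
  then show ?thesis
    using koszul_difference[OF p in_m(1)[OF c], of v] accel_horizontal[OF p c, of v] gab[OF p _ c]
    by (simp add: H.tensor_acceleration[OF p m in_m(1)[OF c]])
qed

lemma cross_derivative_eq:
  assumes "p \<in> pts A" "i \<in> {1..n}"
  shows "field v p (\<lambda>q. gh q (field v q) (X i q)) = cross_derivative i v p"
  unfolding cross_derivative_def by (rule H.const_field_derivative[OF assms(1) sub_m H.X_field[OF assms(2)]])

lemma field_orth_derivative:
  assumes p: "p \<in> pts A" and i: "i \<in> {m+1..n}"
  shows "field v p (\<lambda>q. g q (field v q) (X i q)) = 0"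
proof -
  have "field v p (\<lambda>q. g q (field v q) (X i q)) = field v p (\<lambda>q. 0)"
    by (rule tangent_cong_pts[OF p G.const_field_field[OF sub_m] field_orth[OF _ i]])
  then show ?thesis
    using tangent_const_fun[OF G.const_field_tangent[OF p sub_m] atlas_open_pts[OF G.A] p] by simp
qed

lemma accelh_vertical:
  assumes p: "p \<in> pts A" and i: "i \<in> {m+1..n}"
  shows "(\<Sum>\<gamma>=1..n. accelh \<gamma> v p * gh p (X \<gamma> p) (X i p)) =
    (\<Sum>k=m+1..n. accel k v p * g p (X k p) (X i p)) + cross_derivative i v p - bracket_defect i v p"
  using koszul_difference[OF p in_m(2)[OF i], of v] accel_vertical[OF p i, of v]
    field_orth_derivative[OF p i, of v] cross_derivative_eq[OF p in_m(2)[OF i], of v]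
  by (simp add: H.tensor_acceleration[OF p m in_m(2)[OF i]])

text \<open>The vector \<open>w\<close> below is the difference of the \<open>gh\<close>-acceleration and the part of the
  \<open>g\<close>-acceleration in the distribution.  It vanishes iff its pairings with all frame fields do, and
  these pairings are the defects of (A) and of (B).\<close>
lemma accelerations_agree_iff:
  assumes p: "p \<in> pts A" and nondeg: "nondegenerate_on (gh p) (tangent_space A p)"
  shows "(\<forall>c\<in>{1..m}. accelh c v p = accel c v p) \<and> (\<forall>i\<in>{m+1..n}. accelh i v p = 0) \<longleftrightarrow>
    (\<forall>c\<in>{1..m}. bracket_defect c v p = 0) \<and>
    (\<forall>i\<in>{m+1..n}. (\<Sum>d=1..m. accel d v p * gh p (X d p) (X i p)) =
       (\<Sum>k=m+1..n. accel k v p * g p (X k p) (X i p)) + cross_derivative i v p - bracket_defect i v p)"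
    (is "?geodesic \<longleftrightarrow> ?AB")
proof -
  define w where "w \<gamma> = accelh \<gamma> v p - (if \<gamma> \<le> m then accel \<gamma> v p else 0)" for \<gamma>
  have pair: "(\<Sum>\<gamma>=1..n. w \<gamma> * gh p (X \<gamma> p) (X \<delta> p)) =
      (\<Sum>\<gamma>=1..n. accelh \<gamma> v p * gh p (X \<gamma> p) (X \<delta> p)) - (\<Sum>d=1..m. accel d v p * gh p (X d p) (X \<delta> p))" for \<delta>
  proof -
    have "(\<Sum>\<gamma>=1..n. (if \<gamma> \<le> m then accel \<gamma> v p else 0) * gh p (X \<gamma> p) (X \<delta> p)) =
        (\<Sum>d=1..m. accel d v p * gh p (X d p) (X \<delta> p))"
      by (simp add: sum_split_rank[OF m])
    then show ?thesis
      by (simp add: w_def left_diff_distrib sum_subtractf)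
  qed
  have "?geodesic \<longleftrightarrow> (\<forall>\<gamma>\<in>{1..n}. w \<gamma> = 0)"
  proof
    assume ?geodesic
    then show "\<forall>\<gamma>\<in>{1..n}. w \<gamma> = 0"
      by (auto simp: w_def)
  next
    assume w: "\<forall>\<gamma>\<in>{1..n}. w \<gamma> = 0"
    show ?geodesic
    proof (intro conjI ballI)
      fix c assume "c \<in> {1..m}"
      then show "accelh c v p = accel c v p"
        using bspec[OF w in_m(1)] by (simp add: w_def)
    next
      fix i assume "i \<in> {m+1..n}"
      then show "accelh i v p = 0"
        using bspec[OF w in_m(2)] by (simp add: w_def)
    qed
  qed
  also have "\<dots> \<longleftrightarrow> (\<forall>\<delta>\<in>{1..n}. (\<Sum>\<gamma>=1..n. w \<gamma> * gh p (X \<gamma> p) (X \<delta> p)) = 0)"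
  proof
    assume z: "\<forall>\<delta>\<in>{1..n}. (\<Sum>\<gamma>=1..n. w \<gamma> * gh p (X \<gamma> p) (X \<delta> p)) = 0"
    let ?w = "lin_comb {1..n} (\<lambda>\<gamma>. X \<gamma> p) w"
    have wT: "?w \<in> tangent_space A p"
      by (rule frame_tangent[OF G.A G.fr p order_refl])
    have "gh p ?w (X \<delta> p) = 0" if "\<delta> \<in> {1..n}" for \<delta>
      using tensor_lin_comb_left[OF H.A H.s H.X_tangent[OF p that] H.X_tangent[OF p], of "{1..n}" "\<lambda>\<gamma>. \<gamma>" w]
        z that by simp
    then have "gh p ?w u = 0" if "u \<in> tangent_space A p" for u
      using tensor_lin_comb_right[OF H.A H.s wT H.X_tangent[OF p], of "{1..n}" "\<lambda>\<gamma>. \<gamma>" "\<lambda>\<delta>. frame_comp n X \<delta> (p, u)"]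
        frame_expand[OF H.fr that] by simp
    then have "?w = (\<lambda>f. 0)"
      using nondeg wT by (auto simp: nondegenerate_on_def)
    then show "\<forall>\<gamma>\<in>{1..n}. w \<gamma> = 0"
      using frame_independent[OF G.A G.fr p order_refl] by blast
  qed simp
  also have "\<dots> \<longleftrightarrow> (\<forall>c\<in>{1..m}. (\<Sum>\<gamma>=1..n. w \<gamma> * gh p (X \<gamma> p) (X c p)) = 0) \<and>
      (\<forall>i\<in>{m+1..n}. (\<Sum>\<gamma>=1..n. w \<gamma> * gh p (X \<gamma> p) (X i p)) = 0)"
  proof -
    have "{1..n} = {1..m} \<union> {m+1..n}"
      using m by auto
    then show ?thesis
      by (metis (no_types, lifting) Un_iff)
  qed
  also have "\<dots> \<longleftrightarrow> ?AB"
    unfolding pair using accelh_horizontal[OF p] accelh_vertical[OF p] by auto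
  finally show ?thesis .
qed

end

section \<open>The nonholonomic vector field\<close>

locale nonholonomic = preserving_pair A n X g nab gh nabh m
  for A :: "('p, 'e::euclidean_space) atlas" and n :: nat and X :: "nat \<Rightarrow> 'p vfield"
    and g :: "'p tensor2" and nab and gh :: "'p tensor2" and nabh and m :: nat +
  fixes D :: "'p \<Rightarrow> 'p tvec set" and Z :: "('p \<times> 'p tvec) vfield"
  assumes D: "q \<in> pts A \<Longrightarrow> D q = range (lin_comb {1..m} (\<lambda>\<alpha>. X \<alpha> q))"
    and pos: "q \<in> pts A \<Longrightarrow> u \<in> tangent_space A q \<Longrightarrow> u \<noteq> (\<lambda>f. 0) \<Longrightarrow> g q u u > 0"
    and Z: "nonholonomic_field A m n X D (kinetic g) Z"
begin

abbreviation TA :: "('p \<times> 'p tvec, 'e \<times> 'e) atlas" where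
  "TA \<equiv> tangent_atlas A"

abbreviation C :: "('p \<times> 'p tvec) set" where
  "C \<equiv> dist_set A D"

lemma C_D: "(p, u) \<in> C \<Longrightarrow> p \<in> pts A \<and> u = field (\<lambda>a. frame_comp n X a (p, u)) p"
proof -
  assume "(p, u) \<in> C"
  then have p: "p \<in> pts A" and "u \<in> D p"
    by (auto simp: dist_set_def)
  then obtain v where v: "u = lin_comb {1..m} (\<lambda>\<alpha>. X \<alpha> p) v"
    using D[OF p] by auto
  have "lin_comb {1..m} (\<lambda>\<alpha>. X \<alpha> p) (\<lambda>a. frame_comp n X a (p, u)) = lin_comb {1..m} (\<lambda>\<alpha>. X \<alpha> p) v"
    by (rule lin_comb_cong) (simp add: v frame_comp_lin_comb[OF G.A G.fr p sub_m])
  with p v show ?thesis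
    by (simp add: const_field_def)
qed

lemma C_tangent: "(p, u) \<in> C \<Longrightarrow> u \<in> tangent_space A p"
  using C_D[of p u] G.const_field_tangent[OF _ sub_m, of p] by metis

lemma local_ext_on_bundle:
  assumes "(p, u) \<in> C" "smooth_near TA (p, u) F"
    and "\<And>q w. (q, w) \<in> C \<Longrightarrow> F (q, w) = h (q, w)"
  shows "local_ext TA C (p, u) h F"
  unfolding local_ext_def near_def
  using assms(2,3) atlas_open_tangent[OF G.A] C_tangent[OF assms(1)] C_D[OF assms(1)]
  by (intro conjI exI[of _ "pts TA"]) (auto simp: pts_tangent_atlas)

text \<open>The functions \<open>f\<^sup>a\<close> in \<open>v\<^sup>a X\<^sub>a\<^sup>C + f\<^sup>a X\<^sub>a\<^sup>V\<close>.\<close>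
definition vertical_coeff :: "nat \<Rightarrow> 'p \<times> 'p tvec \<Rightarrow> real" where
  "vertical_coeff = (SOME F. \<forall>x\<in>C. Z x = (\<lambda>K. \<Sum>a=1..m.
     frame_comp n X a x * complete_lift A (X a) x K + F a x * vertical_lift A (X a) x K))"

lemma Z_eq:
  assumes "x \<in> C"
  shows "Z x = (\<lambda>K. \<Sum>a=1..m.
     frame_comp n X a x * complete_lift A (X a) x K + vertical_coeff a x * vertical_lift A (X a) x K)"
proof -
  have "\<exists>F. \<forall>x\<in>C. Z x = (\<lambda>K. \<Sum>a=1..m.
     frame_comp n X a x * complete_lift A (X a) x K + F a x * vertical_lift A (X a) x K)"
    using Z unfolding nonholonomic_field_def by blast
  from someI_ex[OF this] assms show ?thesis
    unfolding vertical_coeff_def by blast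
qed

lemma Z_sub_tangent: "x \<in> C \<Longrightarrow> Z x \<in> sub_tangent_space TA C x"
  using Z unfolding nonholonomic_field_def by blast

lemma apply_Z_contract:
  assumes s: "framed_connection A n X s nab'" and x: "(p, u) \<in> C" and Y: "vector_field A Y"
    and h: "\<And>q w. (q, w) \<in> C \<Longrightarrow> s q w (Y q) = h (q, w)"
  defines "V \<equiv> field (\<lambda>a. frame_comp n X a (p, u))"
  shows "sub_apply TA C Z h (p, u) =
    V p (\<lambda>q. s q (V q) (Y q)) + (\<Sum>a=1..m. vertical_coeff a (p, u) * s p (X a p) (Y p))"
proof -
  interpret S: framed_connection A n X s nab' by (rule s)
  have p: "p \<in> pts A" and u: "V p = u"
    using C_D[OF x] by (auto simp: V_def)
  have "local_ext TA C (p, u) h (contract s Y)"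
    by (rule local_ext_on_bundle[OF x S.contract_smooth_near[OF Y C_tangent[OF x]]])
       (simp add: contract_def h)
  then have "sub_apply TA C Z h (p, u) = Z (p, u) (contract s Y)"
    using sub_apply_eq[where B = TA and x = "(p, u)"] bundle_inj_charts[OF G.A] Z_sub_tangent[OF x] by blast
  also have "\<dots> = V p (\<lambda>q. s q (V q) (Y q)) + (\<Sum>a=1..m. vertical_coeff a (p, u) * s p (X a p) (Y p))"
    unfolding Z_eq[OF x]
    using S.second_order_contract[OF p sub_m Y, of "\<lambda>a. frame_comp n X a (p, u)" "\<lambda>a. vertical_coeff a (p, u)"] u
    by (simp add: V_def)
  finally show ?thesis .
qed

lemma euler_lagrange_expression:
  assumes x: "(p, u) \<in> C" and Y: "vector_field A Y"
  defines "V \<equiv> field (\<lambda>a. frame_comp n X a (p, u))"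
  shows "sub_apply TA C Z (\<lambda>y. vertical_lift A Y y (kinetic g)) (p, u) - complete_lift A Y (p, u) (kinetic g) =
    g p (nab V V p) (Y p) + (\<Sum>a=1..m. vertical_coeff a (p, u) * g p (X a p) (Y p))"
proof -
  have p: "p \<in> pts A" and u: "V p = u" and V: "vector_field A V"
    using C_D[OF x] G.const_field_field[OF sub_m] by (auto simp: V_def)
  have "sub_apply TA C Z (\<lambda>y. vertical_lift A Y y (kinetic g)) (p, u) =
      V p (\<lambda>q. g q (V q) (Y q)) + (\<Sum>a=1..m. vertical_coeff a (p, u) * g p (X a p) (Y p))"
    unfolding V_def
    by (rule apply_Z_contract[OF G.framed_connection_axioms x Y])
       (simp add: G.vertical_lift_kinetic[OF Y C_tangent])
  then show ?thesis
    using G.complete_lift_kinetic[OF p V Y] G.acceleration_koszul[OF p V Y] by (simp add: u)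
qed

text \<open>The equations of motion say that \<open>\<nabla>\<^sub>V V + f\<^sup>a X\<^sub>a\<close> is orthogonal to the distribution.  So
  its tangential part is orthogonal to itself, and vanishes because \<open>g\<close> is positive.\<close>
lemma vertical_coeff_eq:
  assumes x: "(p, u) \<in> C" and a: "a \<in> {1..m}"
  shows "vertical_coeff a (p, u) = - accel a (\<lambda>a. frame_comp n X a (p, u)) p"
proof -
  let ?v = "\<lambda>a. frame_comp n X a (p, u)"
  have p: "p \<in> pts A"
    using C_D[OF x] by simp
  define r where "r d = accel d ?v p + vertical_coeff d (p, u)" for d
  let ?w = "lin_comb {1..m} (\<lambda>\<alpha>. X \<alpha> p) r"
  have wT: "?w \<in> tangent_space A p"
    by (rule frame_tangent[OF G.A G.fr p sub_m])
  have Xc: "g p ?w (X c p) = 0" if c: "c \<in> {1..m}" for c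
  proof -
    have Xc: "vector_field A (X c)"
      by (rule G.X_field[OF in_m(1)[OF c]])
    \<comment> \<open>\<open>X\<^sub>c\<close> is a section of the distribution, so the equation of motion applies to it.\<close>
    have "X c q \<in> D q" if q: "q \<in> pts A" for q
    proof -
      have "X c q = lin_comb {1..m} (\<lambda>\<alpha>. X \<alpha> q) (\<lambda>\<alpha>. if \<alpha> = c then 1 else 0)"
        using c by (auto simp: lin_comb_def if_distrib[of "\<lambda>z. z * _"] cong: if_cong)
      then show ?thesis
        using D[OF q] by auto
    qed
    then have "sub_apply TA C Z (\<lambda>y. vertical_lift A (X c) y (kinetic g)) (p, u)
        - complete_lift A (X c) (p, u) (kinetic g) = 0"
      using Z Xc x unfolding nonholonomic_field_def by blast
    then have "(\<Sum>d=1..m. accel d ?v p * g p (X d p) (X c p)) + (\<Sum>d=1..m. vertical_coeff d (p, u) * g p (X d p) (X c p)) = 0"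
      unfolding euler_lagrange_expression[OF x Xc] accel_horizontal[OF p c] .
    then have "(\<Sum>d=1..m. r d * g p (X d p) (X c p)) = 0"
      by (simp add: r_def distrib_right sum.distrib)
    then show ?thesis
      using tensor_lin_comb_left[OF G.A G.s G.X_tangent[OF p in_m(1)[OF c]] G.X_tangent[OF p in_m(1)],
          of "{1..m}" "\<lambda>d. d" r] by simp
  qed
  then have "g p ?w ?w = 0"
    using tensor_lin_comb_right[OF G.A G.s wT G.X_tangent[OF p in_m(1)], of "{1..m}" "\<lambda>d. d" r] by simp
  then have "?w = (\<lambda>f. 0)"
    using pos[OF p wT] by fastforce
  then have "r a = 0"
    using frame_independent[OF G.A G.fr p sub_m _ a] by blast
  then show ?thesis
    by (simp add: r_def)
qed

text \<open>The fields \<open>X\<^sub>i\<close> are orthogonal to the distribution, so the vertical part of \<open>Z\<close> does not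
  contribute, and of \<open>\<nabla>\<^sub>V V\<close> only the normal part remains.\<close>
lemma multiplier_eq:
  assumes x: "(p, u) \<in> C" and i: "i \<in> {m+1..n}"
  shows "multiplier A D X (kinetic g) Z i (p, u) =
    (\<Sum>k=m+1..n. accel k (\<lambda>a. frame_comp n X a (p, u)) p * g p (X k p) (X i p))"
proof -
  have p: "p \<in> pts A"
    using C_D[OF x] by simp
  have "(\<Sum>a=1..m. vertical_coeff a (p, u) * g p (X a p) (X i p)) = 0"
    using gai[OF p _ i] by simp
  then show ?thesis
    unfolding multiplier_def euler_lagrange_expression[OF x G.X_field[OF in_m(2)[OF i]]]
    by (simp add: accel_vertical[OF p i])
qed

text \<open>On the distribution \<open>\<theta>\<^sub>i\<close> is the restriction of \<open>u \<mapsto> gh(u, X\<^sub>i)\<close>, which serves as its smooth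
  extension.\<close>
lemma apply_Z_theta:
  assumes x: "(p, u) \<in> C" and i: "i \<in> {1..n}"
    and \<theta>: "\<And>y. \<theta> y = (\<Sum>a=1..m. gh (fst y) (X a (fst y)) (X i (fst y)) * frame_comp n X a y)"
  shows "sub_apply TA C Z \<theta> (p, u) = cross_derivative i (\<lambda>a. frame_comp n X a (p, u)) p
    - (\<Sum>d=1..m. accel d (\<lambda>a. frame_comp n X a (p, u)) p * gh p (X d p) (X i p))"
proof -
  have p: "p \<in> pts A"
    using C_D[OF x] by simp
  have "gh q w (X i q) = \<theta> (q, w)" if y: "(q, w) \<in> C" for q w
  proof -
    have q: "q \<in> pts A" and w: "w = lin_comb {1..m} (\<lambda>\<alpha>. X \<alpha> q) (\<lambda>a. frame_comp n X a (q, w))"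
      using C_D[OF y] by (auto simp: const_field_def)
    have "gh q w (X i q) = gh q (lin_comb {1..m} (\<lambda>\<alpha>. X \<alpha> q) (\<lambda>a. frame_comp n X a (q, w))) (X i q)"
      using w by simp
    also have "\<dots> = (\<Sum>a=1..m. frame_comp n X a (q, w) * gh q (X a q) (X i q))"
      by (rule tensor_lin_comb_left[OF H.A H.s H.X_tangent[OF q i] H.X_tangent[OF q in_m(1)]])
    finally show ?thesis
      by (simp add: \<theta> mult.commute)
  qed
  then have "sub_apply TA C Z \<theta> (p, u) =
      field (\<lambda>a. frame_comp n X a (p, u)) p (\<lambda>q. gh q (field (\<lambda>a. frame_comp n X a (p, u)) q) (X i q)) +
      (\<Sum>a=1..m. vertical_coeff a (p, u) * gh p (X a p) (X i p))"
    by (rule apply_Z_contract[OF H.framed_connection_axioms x H.X_field[OF i]])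
  then show ?thesis
    by (simp add: cross_derivative_eq[OF p i] vertical_coeff_eq[OF x] sum_negf)
qed

end

section \<open>Equivalence of the equations and their form on the distribution\<close>

theorem lemma2:
  fixes A :: "('q, 'e::euclidean_space) atlas"
    and g gh :: "'q tensor2"
    and D :: "'q \<Rightarrow> 'q tvec set"
    and X :: "nat \<Rightarrow> 'q vfield"
    and nab nabh :: "'q vfield \<Rightarrow> 'q vfield \<Rightarrow> 'q vfield"
    and Z :: "('q \<times> 'q tvec) vfield"
    and m n :: nat
    and Q :: "'q set" and C :: "('q \<times> 'q tvec) set" and L :: "'q \<times> 'q tvec \<Rightarrow> real"
    and gc gch :: "nat \<Rightarrow> nat \<Rightarrow> 'q \<Rightarrow> real"
    and R Gam Gamh :: "nat \<Rightarrow> nat \<Rightarrow> nat \<Rightarrow> 'q \<Rightarrow> real"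
    and qv lam \<theta> :: "nat \<Rightarrow> 'q \<times> 'q tvec \<Rightarrow> real"
  assumes manifold: "smooth_manifold A" and dim: "n = DIM('e)" and Q: "Q = pts A"
    and g: "riemannian_metric A g" and L: "L = kinetic g"
    and m: "m \<le> n"
    and frame: "global_frame A n X"
    and D: "\<forall>q\<in>Q. D q = range (lin_comb {1..m} (\<lambda>\<alpha>. X \<alpha> q))"
    and Dg: "\<forall>q\<in>Q. orth_compl A g D q = range (lin_comb {m+1..n} (\<lambda>\<alpha>. X \<alpha> q))"
    and gh: "pseudo_riemannian_metric A gh"
    and modification: "preserving_modification A D g gh"
    and nondeg: "\<forall>q\<in>Q. nondegenerate_on (gh q) (orth_compl A gh D q)"
    and nab: "levi_civita A g nab" and nabh: "levi_civita A gh nabh"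
    and gc: "\<And>\<alpha> \<beta> q. gc \<alpha> \<beta> q = g q (X \<alpha> q) (X \<beta> q)"
    and gch: "\<And>\<alpha> \<beta> q. gch \<alpha> \<beta> q = gh q (X \<alpha> q) (X \<beta> q)"
    and R: "R = structure_fun A n X"
    and Gam: "Gam = christoffel n X nab" and Gamh: "Gamh = christoffel n X nabh"
    and C: "C = dist_set A D" and qv: "qv = frame_comp n X"
    and Z: "nonholonomic_field A m n X D L Z" and lam: "lam = multiplier A D X L Z"
    and \<theta>: "\<And>i x. \<theta> i x = (\<Sum>a=1..m. gch a i (fst x) * qv a x)"
  shows "let eqA = (\<lambda>q v c. (\<Sum>a=1..m. \<Sum>b=1..m. \<Sum>k=m+1..n.
                   gch b k q * R k a c q * v a * v b) = 0);
             eqB = (\<lambda>q v i. (\<Sum>a=1..m. \<Sum>b=1..m. \<Sum>d=1..m.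
                   gch d i q * Gam d a b q * v a * v b)
                 = (\<Sum>a=1..m. \<Sum>b=1..m.
                     ((\<Sum>k=m+1..n. gc k i q * Gam k a b q) + X a q (gch b i)
                       - (\<Sum>k=m+1..n. gch b k q * R k a i q)) * v a * v b))
         in
          ((\<forall>q\<in>Q. \<forall>v :: nat \<Rightarrow> real.
              (\<forall>c\<in>{1..m}. (\<Sum>a=1..m. \<Sum>b=1..m. Gamh c a b q * v a * v b)
                          = (\<Sum>a=1..m. \<Sum>b=1..m. Gam c a b q * v a * v b)) \<and>
              (\<forall>i\<in>{m+1..n}. (\<Sum>a=1..m. \<Sum>b=1..m. Gamh i a b q * v a * v b) = 0))
           \<longleftrightarrow>
           (\<forall>q\<in>Q. \<forall>v :: nat \<Rightarrow> real.
              (\<forall>c\<in>{1..m}. eqA q v c) \<and> (\<forall>i\<in>{m+1..n}. eqB q v i)))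
          \<and>
          (\<forall>x\<in>C.
              (\<forall>c\<in>{1..m}. eqA (fst x) (\<lambda>a. qv a x) c \<longleftrightarrow>
                 (\<Sum>k=m+1..n. \<Sum>a=1..m. \<theta> k x * R k a c (fst x) * qv a x) = 0) \<and>
              (\<forall>i\<in>{m+1..n}. eqB (fst x) (\<lambda>a. qv a x) i \<longleftrightarrow>
                 sub_apply (tangent_atlas A) C Z (\<theta> i) x
                 + (\<Sum>k=m+1..n. \<Sum>a=1..m. \<theta> k x * R k i a (fst x) * qv a x)
                 + lam i x = 0))"
proof -
  have XD: "lin_comb J e (\<lambda>\<alpha>. if \<alpha> = a then 1 else 0) = e a" if "a \<in> J" "finite J"
    for a J and e :: "nat \<Rightarrow> 'q tvec"
    using that by (auto simp: lin_comb_def if_distrib[of "\<lambda>z. z * _"] cong: if_cong)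
  have X_D: "X a q \<in> D q" if "q \<in> Q" "a \<in> {1..m}" for q a
    using D that XD[of a "{1..m}" "\<lambda>\<alpha>. X \<alpha> q"] by (metis finite_atLeastAtMost rangeI)
  have X_orth: "X i q \<in> orth_compl A g D q" if "q \<in> Q" "i \<in> {m+1..n}" for q i
    using Dg that XD[of i "{m+1..n}" "\<lambda>\<alpha>. X \<alpha> q"] by (metis finite_atLeastAtMost rangeI)
  have A: "smooth_atlas A"
    using manifold by (simp add: smooth_manifold_def)
  have gs: "sym_tensor_field A g" "sym_tensor_field A gh"
    using g gh by (auto simp: riemannian_metric_def pseudo_riemannian_metric_def)
  have XT: "X \<alpha> q \<in> tangent_space A q" if "q \<in> Q" "\<alpha> \<in> {1..n}" for \<alpha> q
    using vector_field_tangent[OF frame_vector_field[OF frame that(2)]] that(1) Q by simp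
  have g_D: "gh p (X a p) (X b p) = g p (X a p) (X b p)" if "p \<in> pts A" "a \<in> {1..m}" "b \<in> {1..m}" for p a b
    using modification X_D[of p] that Q by (simp add: preserving_modification_def)
  have g_orth: "g p (X a p) (X i p) = 0" if "p \<in> pts A" "a \<in> {1..m}" "i \<in> {m+1..n}" for p a i
  proof -
    have "g p (X i p) (X a p) = 0"
      using X_orth[of p i] X_D[of p a] that Q by (simp add: orth_compl_def)
    then show ?thesis
      using tensor_sym[OF gs(1) XT XT, of p a i] that m Q by simp
  qed
  have g_pos: "g q u u > 0" if "q \<in> pts A" "u \<in> tangent_space A q" "u \<noteq> (\<lambda>f. 0)" for q u
    using g that by (simp add: riemannian_metric_def)
  have D_span: "D q = range (lin_comb {1..m} (\<lambda>\<alpha>. X \<alpha> q))" if "q \<in> pts A" for q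
    using D that Q by simp
  have Z_kinetic: "nonholonomic_field A m n X D (kinetic g) Z"
    using Z L by simp
  interpret nonholonomic A n X g nab gh nabh m D Z
    by unfold_locales (fact A dim frame gs nab nabh m g_D g_orth g_pos D_span Z_kinetic)+
  have gch': "gch b i = (\<lambda>q. gh q (X b q) (X i q))" for b i
    using gch by blast
  have eqA: "(\<Sum>a=1..m. \<Sum>b=1..m. \<Sum>k=m+1..n. gch b k q * R k a c q * v a * v b) = bracket_defect c v q"
    for q v c
    by (simp add: bracket_defect_def gch R)
  have eqB_left: "(\<Sum>a=1..m. \<Sum>b=1..m. \<Sum>d=1..m. gch d i q * Gam d a b q * v a * v b) =
      (\<Sum>d=1..m. accel d v q * gh q (X d q) (X i q))" for q v i
    using sum_quadratic_contract[of "\<lambda>d. gch d i q" "\<lambda>d a b. Gam d a b q" "{1..m}" v "{1..m}" "{1..m}"]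
    by (simp add: sum_distrib_right acceleration_def gch Gam)
  have eqB_right: "(\<Sum>a=1..m. \<Sum>b=1..m. ((\<Sum>k=m+1..n. gc k i q * Gam k a b q) + X a q (gch b i)
        - (\<Sum>k=m+1..n. gch b k q * R k a i q)) * v a * v b) =
      (\<Sum>k=m+1..n. accel k v q * g q (X k q) (X i q)) + cross_derivative i v q - bracket_defect i v q" for q v i
  proof -
    have "(\<Sum>a=1..m. \<Sum>b=1..m. (\<Sum>k=m+1..n. gch b k q * R k a i q) * v a * v b) = bracket_defect i v q"
      by (simp add: sum_distrib_right eqA[symmetric])
    moreover have "(\<Sum>a=1..m. \<Sum>b=1..m. (\<Sum>k=m+1..n. gc k i q * Gam k a b q) * v a * v b) =
        (\<Sum>k=m+1..n. accel k v q * g q (X k q) (X i q))"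
      unfolding sum_quadratic_contract by (simp add: acceleration_def gc Gam)
    ultimately show ?thesis
      by (simp add: left_diff_distrib distrib_right sum.distrib sum_subtractf cross_derivative_def gch')
  qed
  have theta_sum: "(\<Sum>k=m+1..n. \<Sum>a=1..m. \<theta> k x * structure_fun A n X k a \<delta> (fst x) * qv a x) =
      bracket_defect \<delta> (\<lambda>a. qv a x) (fst x)" for x \<delta>
  proof -
    have "(\<Sum>k=m+1..n. \<Sum>a=1..m. \<theta> k x * structure_fun A n X k a \<delta> (fst x) * qv a x) =
      (\<Sum>a=1..m. \<Sum>k=m+1..n. \<Sum>b=1..m. gh (fst x) (X b (fst x)) (X k (fst x)) *
        structure_fun A n X k a \<delta> (fst x) * qv a x * qv b x)"
      by (subst sum.swap) (simp add: \<theta> gch sum_distrib_left sum_distrib_right ac_simps)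
    also have "\<dots> = bracket_defect \<delta> (\<lambda>a. qv a x) (fst x)"
      unfolding bracket_defect_def by (intro sum.cong refl sum.swap)
    finally show ?thesis .
  qed
  have nonholonomic_B: "sub_apply (tangent_atlas A) C Z (\<theta> i) x
      + (\<Sum>k=m+1..n. \<Sum>a=1..m. \<theta> k x * R k i a (fst x) * qv a x) + lam i x =
      (\<Sum>k=m+1..n. accel k (\<lambda>a. qv a x) (fst x) * g (fst x) (X k (fst x)) (X i (fst x)))
      + cross_derivative i (\<lambda>a. qv a x) (fst x) - bracket_defect i (\<lambda>a. qv a x) (fst x)
      - (\<Sum>d=1..m. accel d (\<lambda>a. qv a x) (fst x) * gh (fst x) (X d (fst x)) (X i (fst x)))"
    if x: "x \<in> C" and i: "i \<in> {m+1..n}" for x i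
  proof -
    obtain p u where pu: "x = (p, u)"
      by (cases x)
    have xC: "(p, u) \<in> dist_set A D"
      using x C pu by simp
    have p: "p \<in> pts A"
      using C_D[OF xC] by simp
    have "R k i a p = - structure_fun A n X k a i p" if "k \<in> {m+1..n}" "a \<in> {1..m}" for k a
      unfolding R by (rule G.structure_fun_anti[OF p in_m(1)[OF that(2)] in_m(2)[OF i] in_m(2)[OF that(1)]])
    then have "(\<Sum>k=m+1..n. \<Sum>a=1..m. \<theta> k x * R k i a (fst x) * qv a x) =
        - (\<Sum>k=m+1..n. \<Sum>a=1..m. \<theta> k x * structure_fun A n X k a i (fst x) * qv a x)"
      by (simp add: pu sum_negf)
    moreover have "sub_apply (tangent_atlas A) C Z (\<theta> i) x =
        cross_derivative i (\<lambda>a. qv a x) p - (\<Sum>d=1..m. accel d (\<lambda>a. qv a x) p * gh p (X d p) (X i p))"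
      unfolding C pu qv by (rule apply_Z_theta[OF xC in_m(2)[OF i]]) (simp add: \<theta> gch qv)
    moreover have "lam i x = (\<Sum>k=m+1..n. accel k (\<lambda>a. qv a x) p * g p (X k p) (X i p))"
      unfolding lam L pu qv by (rule multiplier_eq[OF xC i])
    ultimately show ?thesis
      using theta_sum[where x = x and \<delta> = i] by (simp add: pu)
  qed
  have star: "(\<forall>c\<in>{1..m}. (\<Sum>a=1..m. \<Sum>b=1..m. Gamh c a b q * v a * v b)
        = (\<Sum>a=1..m. \<Sum>b=1..m. Gam c a b q * v a * v b)) \<and>
      (\<forall>i\<in>{m+1..n}. (\<Sum>a=1..m. \<Sum>b=1..m. Gamh i a b q * v a * v b) = 0) \<longleftrightarrow>
    (\<forall>c\<in>{1..m}. bracket_defect c v q = 0) \<and>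
    (\<forall>i\<in>{m+1..n}. (\<Sum>d=1..m. accel d v q * gh q (X d q) (X i q)) =
       (\<Sum>k=m+1..n. accel k v q * g q (X k q) (X i q)) + cross_derivative i v q - bracket_defect i v q)"
    if q: "q \<in> Q" for q v
    using accelerations_agree_iff[of q v] gh q Q
    by (simp add: pseudo_riemannian_metric_def acceleration_def Gam Gamh)
  show ?thesis
    unfolding Let_def eqA eqB_left eqB_right
  proof (rule conjI)
    show "(\<forall>q\<in>Q. \<forall>v. (\<forall>c\<in>{1..m}. (\<Sum>a=1..m. \<Sum>b=1..m. Gamh c a b q * v a * v b)
        = (\<Sum>a=1..m. \<Sum>b=1..m. Gam c a b q * v a * v b)) \<and>
      (\<forall>i\<in>{m+1..n}. (\<Sum>a=1..m. \<Sum>b=1..m. Gamh i a b q * v a * v b) = 0)) \<longleftrightarrow>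
     (\<forall>q\<in>Q. \<forall>v. (\<forall>c\<in>{1..m}. bracket_defect c v q = 0) \<and>
      (\<forall>i\<in>{m+1..n}. (\<Sum>d=1..m. accel d v q * gh q (X d q) (X i q)) =
       (\<Sum>k=m+1..n. accel k v q * g q (X k q) (X i q)) + cross_derivative i v q - bracket_defect i v q))"
      by (intro ball_cong refl arg_cong[of _ _ All] ext star)
  qed (use nonholonomic_B theta_sum in \<open>auto simp: R\<close>)
qed

end
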